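(* Let $\Lambda$ be a finite nonempty set and let $A \subset \Gamma = \Lambda^* \times \Lambda^*$ satisfy $\overline{d}(A)>0$. Then for every $r \in \mathbb{Z}_{>0}$ there exist a positive integer $q$ and an injective map $\phi: B_r(\Lambda^* ) \times \{0,1,\ldots,r\} \to A$ such that: (1) for some constants $c_1,c_2 \in \mathbb{Z}_{\geq 0}$ we have $\operatorname{Level}(\phi(u,j)) = (q|u|+c_1,\, qj+c_2)$ for all $u \in B_r(\Lambda^* )$ and $j \in \{0,1,\ldots,r\}$; (2) for each $j \in \{0,1,\ldots,r\}$ there are an arithmetic subtree $\phi_j : B_r(\Lambda^* ) \to \Lambda^*$ of order $r$ with gap $q$ and an element $y_j \in \Lambda^*$ such that $\phi(u,j) = (\phi_j(u), y_j)$ for all $u \in B_r(\Lambda^* )$.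
   Context: $\Lambda^*$ denotes the free monoid of all finite words over $\Lambda$ (including the empty word $\emptyset$, the identity), with concatenation. For $w \in \Lambda^*$, $|w|$ is its length; $B_r(\Lambda^* ) = \{w : |w| \le r\}$. A word $w'$ is a descendent of $w$ if $w' = wu$ for some $u \in \Lambda^*$. For $S\subset \Lambda^*$, an arithmetic subtree in $S$ of order $r$ with gap $q \in \mathbb{Z}_{>0}$ is a map $\phi : B_r(\Lambda^* ) \to S$ such that for all $w \in B_{r-1}(\Lambda^* )$ and $\lambda \in \Lambda$: $|\phi(w\lambda)| = |\phi(w)| + q$ and $\phi(w\lambda)$ is a descendent of $\phi(w)\lambda$. $\Gamma = \Lambda^*\times\Lambda^*$ with coordinatewise multiplication; for $\gamma=(w_1,w_2)$, $\operatorname{Level}(\gamma) = (|w_1|,|w_2|)$, and $L_{i,j} = \{\gamma \in \Gamma : \operatorname{Level}(\gamma) = (i,j)\}$. The upper density of $A \subset \Gamma$ is $\overline{d}(A) = \limsup_{N\to\infty} \frac{1}{N^2}\sum_{i,j=0}^{N-1} \frac{|A\cap L_{i,j}|}{|L_{i,j}|}$. *)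

theory Defs
  imports "HOL-Analysis.Analysis" "HOL-Library.Sublist"
begin

text \<open>
  The free monoid over an alphabet \<open>\<Lambda>\<close> is \<open>lists \<Lambda>\<close> with \<open>(@)\<close> and \<open>[]\<close>. A word \<open>w'\<close> is a
  descendent of \<open>w\<close> iff \<open>prefix w w'\<close>, that is \<open>w' = w @ u\<close> for some \<open>u\<close>; if \<open>w'\<close> is a word
  over \<open>\<Lambda>\<close>, then so is \<open>u\<close>.
\<close>

definition word_ball :: "'a set \<Rightarrow> nat \<Rightarrow> 'a list set" where
  "word_ball \<Lambda> r = {w \<in> lists \<Lambda>. length w \<le> r}"

text \<open>
  The condition \<open>length w < r\<close> expresses \<open>w \<in> B\<^sub>r\<^sub>-\<^sub>1\<close> without truncated subtraction: for
  \<open>r = 0\<close> there is no such \<open>w\<close>. The values of \<open>\<phi>\<close> outside the ball are irrelevant.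
\<close>

definition arithmetic_subtree ::
    "'a set \<Rightarrow> 'a list set \<Rightarrow> nat \<Rightarrow> nat \<Rightarrow> ('a list \<Rightarrow> 'a list) \<Rightarrow> bool" where
  "arithmetic_subtree \<Lambda> S r q \<phi> \<longleftrightarrow>
     S \<subseteq> lists \<Lambda> \<and> q > 0 \<and> \<phi> \<in> word_ball \<Lambda> r \<rightarrow> S \<and>
     (\<forall>w\<in>lists \<Lambda>. length w < r \<longrightarrow> (\<forall>l\<in>\<Lambda>.
        length (\<phi> (w @ [l])) = length (\<phi> w) + q \<and>
        prefix (\<phi> w @ [l]) (\<phi> (w @ [l]))))"

definition word_pairs :: "'a set \<Rightarrow> ('a list \<times> 'a list) set" where
  "word_pairs \<Lambda> = lists \<Lambda> \<times> lists \<Lambda>"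

definition level :: "'a list \<times> 'a list \<Rightarrow> nat \<times> nat" where
  "level \<gamma> = (length (fst \<gamma>), length (snd \<gamma>))"

definition level_set :: "'a set \<Rightarrow> nat \<Rightarrow> nat \<Rightarrow> ('a list \<times> 'a list) set" where
  "level_set \<Lambda> i j = {\<gamma> \<in> word_pairs \<Lambda>. level \<gamma> = (i, j)}"

text \<open>
  The terms of the sequence lie in \<open>[0, 1]\<close>; they are embedded in \<open>ereal\<close> because \<open>limsup\<close>
  requires a complete lattice.
\<close>

definition upper_density :: "'a set \<Rightarrow> ('a list \<times> 'a list) set \<Rightarrow> ereal" where
  "upper_density \<Lambda> A = limsup (\<lambda>N. ereal (1 / (real N)\<^sup>2 *
     (\<Sum>i<N. \<Sum>j<N. real (card (A \<inter> level_set \<Lambda> i j)) / real (card (level_set \<Lambda> i j)))))"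

end

theory Submission
  imports Defs "HOL-Real_Asymp.Real_Asymp"
begin

text \<open>
  For a word \<open>y\<close> let \<open>A\<^sub>y = {x. (x, y) \<in> A}\<close>. Call a set of levels replete for \<open>A\<^sub>y\<close> if some full
  subtree of \<open>\<Lambda>\<^sup>*\<close>, branching exactly at these levels, has all its nodes in \<open>A\<^sub>y\<close>. Following Pach,
  Solymosi and Tardos, the number of replete sets is at least exponential in the sum of the
  densities of \<open>A\<^sub>y\<close> over the levels below \<open>N\<close>, so that some replete set contains a positive proportion
  of these levels. Choosing for each \<open>j\<close> the best word \<open>y\<close> of length \<open>j\<close> yields a dense set of pairs
  of levels \<open>(i, j)\<close>, and a grid \<open>{(c\<^sub>1 + q i, c\<^sub>2 + q j). i, j \<le> r}\<close> inside this set is all that is needed.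

  Such a grid is provided by the two-dimensional Szemeredi theorem, which follows from the density
  Hales-Jewett theorem. The latter is proved by induction on the alphabet, in the spirit of Polymath
  and of Dodos, Kanellopoulos and Tyros, but the density increment strategy is replaced by an extremal
  argument at the critical density.
\<close>

section \<open>Words and combinatorial subspaces\<close>

text \<open>The order of the constants shapes the induction on the alphabet. Handling intersections
  of insensitive sets takes a dimension \<open>M\<close> that depends on the error
  \<open>\<eta>\<close>, and \<open>\<eta>\<close> must be small against the proportion
  \<open>\<gamma>\<close> of words \<open>z\<close> all of whose \<open>sub K i z\<close> lie in the
  section. So \<open>\<gamma>\<close> must not depend on \<open>M\<close>, and one subspace must
  serve many suffixes \<open>y\<close> at once. Finding a subspace for each \<open>y\<close> and
  then pigeonholing over the subspaces would lose a factor depending on \<open>M\<close>. Instead a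
  single line is found in a block of fixed length \<open>m\<close>, and its wildcard is copied to
  later coordinates, so that one line spawns a subspace full of lines. At the critical density every
  section over a short prefix is nearly extremal: none is much denser, hence none can be much
  sparser. In the tree part a replete set is common to all branches of one subtree, so a progression
  of levels inside it is all that an arithmetic subtree needs. The second coordinate needs only one
  word per level; the common gap \<open>q\<close> comes from the grid.\<close>

definition words :: "nat \<Rightarrow> nat \<Rightarrow> nat list set" where
  "words K n = {w. set w \<subseteq> {..<K} \<and> length w = n}"

text \<open>
  A template describes a combinatorial subspace: \<open>Inl c\<close> is the constant letter \<open>c\<close> and \<open>Inr j\<close> is the
  \<open>j\<close>-th variable. A combinatorial line in the words over \<open>{..<K}\<close> is encoded as a word over
  \<open>{..<Suc K}\<close> in which \<open>K\<close> plays the role of the variable.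
\<close>

definition fill :: "(nat + nat) list \<Rightarrow> nat list \<Rightarrow> nat list" where
  "fill v w = map (case_sum (\<lambda>c. c) ((!) w)) v"

definition templates :: "nat \<Rightarrow> nat \<Rightarrow> nat \<Rightarrow> (nat + nat) list set" where
  "templates C m n = {v. length v = n \<and> set v \<subseteq> Inl ` {..<C} \<union> Inr ` {..<m} \<and> Inr ` {..<m} \<subseteq> set v}"

definition sub :: "nat \<Rightarrow> nat \<Rightarrow> nat list \<Rightarrow> nat list" where
  "sub K i z = map (\<lambda>a. if a = K then i else a) z"

lemma finite_words [simp]: "finite (words K n)"
  by (simp add: words_def finite_lists_length_eq)

lemma card_words [simp]: "card (words K n) = K ^ n"
  by (simp add: words_def card_lists_length_eq)

lemma length_words: "w \<in> words K n \<Longrightarrow> length w = n"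
  by (simp add: words_def)

lemma nth_words: "w \<in> words K n \<Longrightarrow> i < n \<Longrightarrow> w ! i < K"
  unfolding words_def using nth_mem by blast

lemma words_0 [simp]: "words K 0 = {[]}"
  by (auto simp: words_def)

lemma words_mono: "K \<le> L \<Longrightarrow> words K n \<subseteq> words L n"
  by (auto simp: words_def)

lemma Cons_in_words [simp]: "a # w \<in> words K (Suc n) \<longleftrightarrow> a < K \<and> w \<in> words K n"
  by (auto simp: words_def)

lemma bij_betw_words_append:
  "bij_betw (\<lambda>(u, v). u @ v) (words K m \<times> words K n) (words K (m + n))"
proof (rule bij_betw_byWitness[where f' = "\<lambda>w. (take m w, drop m w)"])
  show "(\<lambda>w. (take m w, drop m w)) ` words K (m + n) \<subseteq> words K m \<times> words K n"
    by (auto simp: words_def dest: in_set_takeD in_set_dropD)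
qed (auto simp: words_def)

lemma sum_words_append:
  "(\<Sum>w\<in>words K (m + n). f w) = (\<Sum>u\<in>words K m. \<Sum>v\<in>words K n. f (u @ v))"
proof -
  have "(\<Sum>w\<in>words K (m + n). f w) = (\<Sum>(u, v)\<in>words K m \<times> words K n. f (u @ v))"
    using sum.reindex_bij_betw[OF bij_betw_words_append, of f] by (simp add: case_prod_unfold)
  then show ?thesis
    by (simp add: sum.cartesian_product)
qed

lemma sum_words_Suc:
  "(\<Sum>w\<in>words K (Suc n). f w) = (\<Sum>a<K. \<Sum>v\<in>words K n. f (a # v))"
proof -
  have "bij_betw (\<lambda>a. [a]) {..<K} (words K 1)"
    by (rule bij_betw_byWitness[where f' = hd]) (auto simp: words_def length_Suc_conv)
  then show ?thesis
    using sum_words_append[of f K 1 n]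
      sum.reindex_bij_betw[of "\<lambda>a. [a]" "{..<K}" "words K 1" "\<lambda>u. \<Sum>v\<in>words K n. f (u @ v)"]
    by simp
qed

lemma length_fill [simp]: "length (fill v w) = length v"
  by (simp add: fill_def)

lemma fill_append: "fill (u @ v) w = fill u w @ fill v w"
  by (simp add: fill_def)

lemma fill_map_Inl [simp]: "fill (map Inl y) w = y"
  by (induction y) (auto simp: fill_def)

lemma fill_in_words:
  assumes "v \<in> templates C m n" "w \<in> words L m" "C \<le> L"
  shows "fill v w \<in> words L n"
proof -
  have "case_sum (\<lambda>c. c) ((!) w) x < L" if "x \<in> set v" for x
    using that assms nth_words[OF assms(2)] by (auto simp: templates_def)
  then show ?thesis
    using assms by (auto simp: words_def fill_def templates_def)
qed

lemma append_map_Inl_templates: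
  "v \<in> templates C m n \<Longrightarrow> y \<in> words C n' \<Longrightarrow> v @ map Inl y \<in> templates C m (n + n')"
  by (auto simp: templates_def words_def)

lemma map_Inl_append_templates:
  "v \<in> templates C m n \<Longrightarrow> y \<in> words C n' \<Longrightarrow> map Inl y @ v \<in> templates C m (n' + n)"
  by (auto simp: templates_def words_def)

definition template_comp :: "(nat + nat) list \<Rightarrow> (nat + nat) list \<Rightarrow> (nat + nat) list" where
  "template_comp v u = map (case_sum Inl ((!) u)) v"

lemma template_comp_in_templates:
  assumes "v \<in> templates C m n" "u \<in> templates C l m"
  shows "template_comp v u \<in> templates C l n"
proof -
  have u: "length u = m" "set u \<subseteq> Inl ` {..<C} \<union> Inr ` {..<l}" "Inr ` {..<l} \<subseteq> set u"
    and v: "length v = n" "set v \<subseteq> Inl ` {..<C} \<union> Inr ` {..<m}" "Inr ` {..<m} \<subseteq> set v"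
    using assms by (auto simp: templates_def)
  have "case_sum Inl ((!) u) x \<in> Inl ` {..<C} \<union> Inr ` {..<l}" if "x \<in> set v" for x
  proof (cases x)
    case (Inl c)
    then show ?thesis using that v(2) by auto
  next
    case (Inr j)
    then have "j < m" using that v(2) by auto
    then have "u ! j \<in> set u" using u(1) by simp
    then show ?thesis using Inr u(2) by auto
  qed
  moreover have "Inr j \<in> set (template_comp v u)" if "j < l" for j
  proof -
    have "Inr j \<in> set u" using u(3) that by auto
    then obtain i where i: "i < m" "u ! i = Inr j"
      using u(1) by (auto simp: in_set_conv_nth)
    then have "Inr i \<in> set v" using v(3) by auto
    moreover have "Inr j = case_sum Inl ((!) u) (Inr i)" using i by simp
    ultimately show ?thesis
      unfolding template_comp_def set_map by (rule rev_image_eqI)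
  qed
  ultimately show ?thesis
    using v(1) by (auto simp: templates_def template_comp_def)
qed

lemma fill_template_comp:
  assumes "v \<in> templates C m n" "length u = m"
  shows "fill (template_comp v u) w = fill v (fill u w)"
proof -
  have "case_sum (\<lambda>c. c) ((!) w) (case_sum Inl ((!) u) x) = case_sum (\<lambda>c. c) ((!) (fill u w)) x"
    if "x \<in> set v" for x
    using that assms by (auto simp: templates_def fill_def)
  then show ?thesis
    unfolding fill_def[of v "fill u w"] unfolding fill_def[of "template_comp v u"]
    unfolding template_comp_def by simp
qed

lemma length_sub [simp]: "length (sub K i z) = length z"
  by (simp add: sub_def)

lemma sub_append [simp]: "sub K i (u @ v) = sub K i u @ sub K i v"
  by (simp add: sub_def)

lemma sub_sub [simp]: "i \<noteq> K \<Longrightarrow> sub K i (sub K i z) = sub K i z"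
  by (auto simp: sub_def)

lemma sub_id: "z \<in> words K n \<Longrightarrow> sub K i z = z"
  unfolding sub_def words_def by (rule map_idI) auto

lemma sub_in_words: "z \<in> words (Suc K) n \<Longrightarrow> i < K \<Longrightarrow> sub K i z \<in> words K n"
  by (auto simp: sub_def words_def less_Suc_eq)

lemma sub_fill:
  assumes "v \<in> templates K m n" "length w = m"
  shows "sub K i (fill v w) = fill v (sub K i w)"
proof -
  have "(\<lambda>a. if a = K then i else a) (case_sum (\<lambda>c. c) ((!) w) x) = case_sum (\<lambda>c. c) ((!) (sub K i w)) x"
    if "x \<in> set v" for x
    using that assms by (auto simp: templates_def sub_def)
  then show ?thesis
    unfolding fill_def sub_def[of K i "map _ _"] by simp
qed

text \<open>Here constants of \<open>v\<close> may be the letter \<open>K\<close>, so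
  \<open>sub K i\<close> can change them and \<open>sub_fill\<close> fails; an outer
  \<open>sub K i\<close> on both sides absorbs this. It is the form needed for insensitive sets in
  subspaces over \<open>{..<Suc K}\<close>.\<close>

lemma sub_fill_sub:
  assumes "v \<in> templates C m n" "length w = m" "i \<noteq> K"
  shows "sub K i (fill v (sub K i w)) = sub K i (fill v w)"
proof -
  have "(\<lambda>a. if a = K then i else a) (case_sum (\<lambda>c. c) ((!) w) x) =
      (\<lambda>a. if a = K then i else a) (case_sum (\<lambda>c. c) ((!) (sub K i w)) x)"
    if "x \<in> set v" for x
    using that assms by (auto simp: templates_def sub_def)
  then show ?thesis
    by (simp add: fill_def sub_def[of K i "map _ _"])
qed

text \<open>Rests on the requirement that every variable of a template occurs; otherwise a line
  could collapse to a point.\<close>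

lemma wildcard_in_fill:
  assumes "v \<in> templates C m n" "length w = m" "a \<in> set w"
  shows "a \<in> set (fill v w)"
proof -
  obtain j where "j < m" "w ! j = a" using assms by (metis in_set_conv_nth)
  then have "Inr j \<in> set v" using assms by (auto simp: templates_def)
  moreover have "a = case_sum (\<lambda>c. c) ((!) w) (Inr j)" using \<open>w ! j = a\<close> by simp
  ultimately show ?thesis unfolding fill_def set_map by (rule rev_image_eqI)
qed

section \<open>Combinatorial lines and the density Hales-Jewett property\<close>

definition contains_line :: "nat \<Rightarrow> nat \<Rightarrow> nat list set \<Rightarrow> bool" where
  "contains_line K n D \<longleftrightarrow> (\<exists>z\<in>words (Suc K) n. K \<in> set z \<and> (\<forall>i<K. sub K i z \<in> D))"

definition dhj :: "nat \<Rightarrow> bool" where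
  "dhj K \<longleftrightarrow> (\<forall>\<delta>>0. \<exists>N. \<forall>n\<ge>N. \<forall>D\<subseteq>words K n. \<delta> * real K ^ n \<le> real (card D) \<longrightarrow> contains_line K n D)"

lemma contains_line_vimage:
  assumes "v \<in> templates K m n" "contains_line K m {w \<in> words K m. fill v w \<in> D}"
  shows "contains_line K n D"
proof -
  obtain z where z: "z \<in> words (Suc K) m" "K \<in> set z" "\<And>i. i < K \<Longrightarrow> fill v (sub K i z) \<in> D"
    using assms(2) by (auto simp: contains_line_def)
  have "fill v z \<in> words (Suc K) n" "K \<in> set (fill v z)"
    using fill_in_words[OF assms(1) z(1)] wildcard_in_fill[OF assms(1) length_words[OF z(1)] z(2)] by auto
  moreover have "sub K i (fill v z) \<in> D" if "i < K" for i
    using z that sub_fill[OF assms(1)] by (simp add: words_def)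
  ultimately show ?thesis
    unfolding contains_line_def by blast
qed

section \<open>Free coordinates\<close>

lemma templates_mono: "C \<le> C' \<Longrightarrow> templates C m n \<subseteq> templates C' m n"
  using image_mono[of "{..<C}" "{..<C'}" Inl] unfolding templates_def lessThan_subset_iff by blast

lemma map_Inl_templates: "w \<in> words C n \<Longrightarrow> map Inl w \<in> templates C 0 n"
  by (simp add: templates_def words_def image_mono le_supI1)

text \<open>Frees variable 0 for a new block in front; the filling word grows by \<open>#\<close>
  accordingly.\<close>

definition shift :: "(nat + nat) list \<Rightarrow> (nat + nat) list" where
  "shift v = map (map_sum id Suc) v"

lemma fill_shift [simp]: "fill (shift v) (a # w) = fill v w"
proof -
  have "case_sum (\<lambda>c. c) ((!) (a # w)) (map_sum id Suc x) = case_sum (\<lambda>c. c) ((!) w) x" for x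
    by (cases x) auto
  then show ?thesis by (simp add: fill_def shift_def)
qed

lemma set_shift:
  assumes "v \<in> templates C m n"
  shows "length (shift v) = n" "set (shift v) \<subseteq> Inl ` {..<C} \<union> Inr ` {..<Suc m}"
    "Inr ` Suc ` {..<m} \<subseteq> set (shift v)"
proof -
  have v: "length v = n" "set v \<subseteq> Inl ` {..<C} \<union> Inr ` {..<m}" "Inr ` {..<m} \<subseteq> set v"
    using assms by (auto simp: templates_def)
  show "length (shift v) = n" using v by (simp add: shift_def)
  show "set (shift v) \<subseteq> Inl ` {..<C} \<union> Inr ` {..<Suc m}"
    using v(2) by (auto simp: shift_def)
  show "Inr ` Suc ` {..<m} \<subseteq> set (shift v)"
  proof
    fix x :: "nat + nat" assume "x \<in> Inr ` Suc ` {..<m}"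
    then obtain j where "x = Inr (Suc j)" "j < m" by blast
    then have "x = map_sum id Suc (Inr j)" "Inr j \<in> set v" using v(3) by auto
    then show "x \<in> set (shift v)" unfolding shift_def set_map by (rule rev_image_eqI[rotated])
  qed
qed

lemma append_shift_templates:
  assumes "v \<in> templates C m n" "length u = l" "set u \<subseteq> Inl ` {..<C} \<union> {Inr 0}" "Inr 0 \<in> set u"
  shows "u @ shift v \<in> templates C (Suc m) (l + n)"
proof -
  have "{..<Suc m} = insert 0 (Suc ` {..<m})" by (rule lessThan_Suc_eq_insert_0)
  then have "Inr ` {..<Suc m} \<subseteq> set (u @ shift v)"
    using set_shift(3)[OF assms(1)] assms(4) by auto
  then show ?thesis
    using set_shift[OF assms(1)] assms(2,3) by (auto simp: templates_def)
qed

text \<open>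
  Fix all but \<open>m\<close> of the coordinates carrying a letter of \<open>\<iota> ` {..<P}\<close>; the remaining ones
  are then distributed uniformly. The error term bounds the number of words with fewer than \<open>m\<close>
  such coordinates.
\<close>

lemma free_coordinates_bound:
  fixes f :: "nat list \<Rightarrow> real"
  assumes "inj_on \<iota> {..<P}" "\<iota> ` {..<P} \<subseteq> {..<Q}" "P \<ge> 1" "Q \<ge> 2" "0 \<le> \<epsilon>"
    and "\<And>w. w \<in> words Q n \<Longrightarrow> f w \<le> 1"
    and "\<And>v. v \<in> templates Q m n \<Longrightarrow> (\<Sum>w\<in>words P m. f (fill v (map \<iota> w))) \<le> \<epsilon> * real P ^ m"
  shows "(\<Sum>w\<in>words Q n. f w) \<le> \<epsilon> * real Q ^ n + (real Q - 1) ^ n * (1 + real n * real P) ^ m"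
  using assms(6,7)
proof (induction n arbitrary: m f)
  case 0
  show ?case
  proof (cases m)
    case 0
    have "[] \<in> templates Q 0 0" by (simp add: templates_def)
    then show ?thesis using 0 "0.prems"(2)[of "[]"] by (simp add: fill_def)
  next
    case (Suc m')
    then show ?thesis using "0.prems"(1)[of "[]"] \<open>0 \<le> \<epsilon>\<close> by simp
  qed
next
  case (Suc n m f)
  show ?case
  proof (cases m)
    case 0
    have "f w \<le> \<epsilon>" if "w \<in> words Q (Suc n)" for w
      using Suc.prems(2)[of "map Inl w"] map_Inl_templates[OF that] 0 by simp
    then have "(\<Sum>w\<in>words Q (Suc n). f w) \<le> (\<Sum>w\<in>words Q (Suc n). \<epsilon>)"
      by (intro sum_mono)
    also have "\<dots> = \<epsilon> * real Q ^ Suc n" by simp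
    finally show ?thesis using 0 \<open>Q \<ge> 2\<close> by (simp add: add_increasing2)
  next
    case (Suc m')
    define A B E where "A = (real Q - 1) ^ n" and "B = (1 + real n * real P) ^ m'"
      and "E = 1 + real n * real P"
    have nn: "0 \<le> A" "0 \<le> B" "1 \<le> E" using \<open>Q \<ge> 2\<close> by (auto simp: A_def B_def E_def)
    define g where "g c = (\<Sum>w\<in>words Q n. f (c # w))" for c
    have gb: "g c \<le> \<epsilon> * real Q ^ n + A * (B * E)" if "c < Q" for c
    proof -
      have "(\<Sum>w\<in>words P m. f (c # fill v (map \<iota> w))) \<le> \<epsilon> * real P ^ m" if "v \<in> templates Q m n" for v
      proof -
        have "Inl c # v \<in> templates Q m (Suc n)"
          using that \<open>c < Q\<close> by (auto simp: templates_def)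
        from Suc.prems(2)[OF this] show ?thesis by (simp add: fill_def)
      qed
      from Suc.IH[OF _ this] show ?thesis
        using Suc.prems(1) that by (simp add: g_def A_def B_def E_def \<open>m = Suc m'\<close> mult.commute mult.left_commute)
    qed
    \<comment> \<open>If the first letter lies in the image of \<open>\<iota>\<close>, its
      coordinate becomes variable 0. Averaging over the \<open>P\<close> letters removes it, and
      \<open>m'\<close> variables remain to be found.\<close>
    define h where "h w = (\<Sum>a<P. f (\<iota> a # w)) / real P" for w
    have hb: "(\<Sum>w\<in>words Q n. h w) \<le> \<epsilon> * real Q ^ n + A * B"
      unfolding A_def B_def
    proof (rule Suc.IH)
      fix w assume w: "w \<in> words Q n"
      have "(\<Sum>a<P. f (\<iota> a # w)) \<le> (\<Sum>a<P. 1)"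
        using assms(2) w by (intro sum_mono Suc.prems(1)) auto
      then show "h w \<le> 1" using \<open>P \<ge> 1\<close> by (simp add: h_def)
    next
      fix v assume v: "v \<in> templates Q m' n"
      then have "[Inr 0] @ shift v \<in> templates Q (Suc m') (1 + n)"
        by (rule append_shift_templates) auto
      then have "(\<Sum>w\<in>words P m. f (fill (Inr 0 # shift v) (map \<iota> w))) \<le> \<epsilon> * real P ^ m"
        using Suc.prems(2) Suc by simp
      moreover have "fill (Inr 0 # shift v) (a # w) = a # fill v w" for a w
        using fill_append[of "[Inr 0]" "shift v" "a # w"] by (simp add: fill_def[of "[Inr 0]"])
      ultimately have "(\<Sum>a<P. \<Sum>w\<in>words P m'. f (\<iota> a # fill v (map \<iota> w))) \<le> \<epsilon> * real P ^ Suc m'"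
        by (simp add: Suc sum_words_Suc)
      then show "(\<Sum>w\<in>words P m'. h (fill v (map \<iota> w))) \<le> \<epsilon> * real P ^ m'"
        using \<open>P \<ge> 1\<close> unfolding h_def sum_divide_distrib[symmetric]
        by (subst sum.swap) (simp add: field_simps)
    qed
    have "(\<Sum>w\<in>words Q (Suc n). f w) = (\<Sum>c<Q. g c)"
      by (simp add: sum_words_Suc g_def)
    also have "\<dots> = (\<Sum>c\<in>{..<Q} - \<iota> ` {..<P}. g c) + (\<Sum>c\<in>\<iota> ` {..<P}. g c)"
      using assms(2) by (intro sum.subset_diff) auto
    also have "(\<Sum>c\<in>\<iota> ` {..<P}. g c) = real P * (\<Sum>w\<in>words Q n. h w)"
      using assms(1) \<open>P \<ge> 1\<close> unfolding h_def sum_divide_distrib[symmetric] g_def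
      by (simp add: sum.reindex) (subst sum.swap, simp)
    also have "(\<Sum>c\<in>{..<Q} - \<iota> ` {..<P}. g c) \<le> (\<Sum>c\<in>{..<Q} - \<iota> ` {..<P}. \<epsilon> * real Q ^ n + A * (B * E))"
      using gb by (intro sum_mono) auto
    also have "\<dots> = (real Q - real P) * (\<epsilon> * real Q ^ n + A * (B * E))"
    proof -
      have "card (\<iota> ` {..<P}) = P" using assms(1) by (simp add: card_image)
      moreover have "card (\<iota> ` {..<P}) \<le> Q" using card_mono[OF _ assms(2)] by simp
      ultimately show ?thesis using assms(2) by (simp add: card_Diff_subset finite_subset of_nat_diff)
    qed
    also have "real P * (\<Sum>w\<in>words Q n. h w) \<le> real P * (\<epsilon> * real Q ^ n + A * B)"
      using hb by (intro mult_left_mono) auto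
    also have "(real Q - real P) * (\<epsilon> * real Q ^ n + A * (B * E)) + real P * (\<epsilon> * real Q ^ n + A * B)
       = \<epsilon> * real Q ^ Suc n + A * B * ((real Q - real P) * E + real P)"
      by (simp add: algebra_simps)
    \<comment> \<open>Here \<open>E + P\<close> is \<open>1 + (n + 1) * P\<close>, so this is the
      bound for \<open>Suc n\<close>. The crude factor \<open>Q - 1\<close> in place of
      \<open>Q - P\<close> is harmless, as the error only has to be small against
      \<open>Q ^ n\<close>.\<close>
    also have "\<dots> \<le> \<epsilon> * real Q ^ Suc n + A * (E + real P) ^ m' * ((real Q - 1) * (E + real P))"
    proof (intro add_left_mono mult_mono)
      show "B \<le> (E + real P) ^ m'" unfolding B_def E_def by (intro power_mono) auto
      have "(real Q - real P) * E \<le> (real Q - 1) * E"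
        using \<open>P \<ge> 1\<close> nn by (intro mult_right_mono) auto
      moreover have "1 * real P \<le> (real Q - 1) * real P"
        using \<open>Q \<ge> 2\<close> by (intro mult_right_mono) auto
      ultimately show "(real Q - real P) * E + real P \<le> (real Q - 1) * (E + real P)"
        by (simp add: algebra_simps)
      have "real P \<le> real Q"
        using card_mono[OF _ assms(2)] card_image[OF assms(1)] by simp
      then show "0 \<le> (real Q - real P) * E + real P" using nn by simp
    qed (use nn in auto)
    also have "\<dots> = \<epsilon> * real Q ^ Suc n + (real Q - 1) ^ Suc n * (1 + real (Suc n) * real P) ^ m"
      by (simp add: A_def E_def Suc algebra_simps)
    finally show ?thesis by simp
  qed
qed

lemma exp_times_poly_tendsto_0:
  fixes x p :: real assumes "0 < x" "x < 1" "0 < p"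
  shows "(\<lambda>n. x ^ n * (1 + real n * p) ^ m) \<longlonglongrightarrow> 0"
  using assms by real_asymp

text \<open>The exponentially small error costs half of \<open>\<epsilon>\<close>. There are two
  uses: with \<open>\<iota>\<close> the identity it passes from \<open>{..<Suc K}\<close> to the
  alphabet \<open>{..<K}\<close> for which density Hales-Jewett is assumed; with
  \<open>\<iota>\<close> sending \<open>K\<close> to \<open>K + l\<close> it finds coordinates that
  can copy the \<open>l\<close>-th letter of a block.\<close>

lemma free_coordinates:
  fixes \<epsilon> :: real
  assumes "inj_on \<iota> {..<P}" "\<iota> ` {..<P} \<subseteq> {..<Q}" "P \<ge> 1" "Q \<ge> 2" "0 < \<epsilon>"
  shows "\<exists>N. \<forall>n\<ge>N. \<forall>f. (\<forall>w\<in>words Q n. f w \<le> 1) \<longrightarrow> \<epsilon> * real Q ^ n \<le> (\<Sum>w\<in>words Q n. f w) \<longrightarrow>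
    (\<exists>v\<in>templates Q m n. \<epsilon> / 2 * real P ^ m \<le> (\<Sum>w\<in>words P m. f (fill v (map \<iota> w))))"
proof -
  define x where "x = (real Q - 1) / real Q"
  have "0 < x" "x < 1" using \<open>Q \<ge> 2\<close> by (auto simp: x_def)
  then have "\<forall>\<^sub>F n in sequentially. x ^ n * (1 + real n * real P) ^ m < \<epsilon> / 2"
    using exp_times_poly_tendsto_0[of x "real P" m] \<open>P \<ge> 1\<close> \<open>0 < \<epsilon>\<close>
    by (intro order_tendstoD(2)[where y = 0]) auto
  then obtain N where N: "\<And>n. n \<ge> N \<Longrightarrow> x ^ n * (1 + real n * real P) ^ m < \<epsilon> / 2"
    by (auto simp: eventually_sequentially)
  show ?thesis
  proof (intro exI[of _ N] allI impI, rule ccontr)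
    fix n f
    assume "N \<le> n" and f: "\<forall>w\<in>words Q n. f w \<le> (1 :: real)" "\<epsilon> * real Q ^ n \<le> (\<Sum>w\<in>words Q n. f w)"
      and no: "\<not> (\<exists>v\<in>templates Q m n. \<epsilon> / 2 * real P ^ m \<le> (\<Sum>w\<in>words P m. f (fill v (map \<iota> w))))"
    have "(\<Sum>w\<in>words Q n. f w) \<le> \<epsilon> / 2 * real Q ^ n + (real Q - 1) ^ n * (1 + real n * real P) ^ m"
      using assms f(1) no by (intro free_coordinates_bound[where \<iota> = \<iota>]) force+
    also have "(real Q - 1) ^ n * (1 + real n * real P) ^ m = x ^ n * (1 + real n * real P) ^ m * real Q ^ n"
      using \<open>Q \<ge> 2\<close> by (simp add: x_def power_divide)
    also have "\<dots> < \<epsilon> / 2 * real Q ^ n"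
      using N[OF \<open>N \<le> n\<close>] \<open>Q \<ge> 2\<close> by (intro mult_strict_right_mono) auto
    finally show False using f(2) by simp
  qed
qed

section \<open>Subspaces in dense sets and in insensitive sets\<close>

text \<open>Elements below \<open>\<delta> / 2 * G\<close> contribute at most half of the assumed
  sum, and each of the others at most \<open>G\<close>.\<close>

lemma many_large:
  fixes g :: "'b \<Rightarrow> real"
  assumes "finite Y" "\<And>y. y \<in> Y \<Longrightarrow> g y \<le> G" "0 < G" "0 \<le> \<delta>"
    and "\<delta> * real (card Y) * G \<le> sum g Y"
  shows "\<delta> / 2 * real (card Y) \<le> real (card {y \<in> Y. \<delta> / 2 * G \<le> g y})"
proof -
  let ?L = "{y \<in> Y. \<delta> / 2 * G \<le> g y}"
  have "sum g Y = sum g ?L + sum g (Y - ?L)"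
    using assms(1) by (subst sum.subset_diff[of ?L Y]) auto
  also have "sum g ?L \<le> real (card ?L) * G"
    using assms(2) sum_bounded_above[of ?L g G] by simp
  also have "sum g (Y - ?L) \<le> real (card (Y - ?L)) * (\<delta> / 2 * G)"
    using sum_bounded_above[of "Y - ?L" g "\<delta> / 2 * G"] by force
  also have "\<dots> \<le> real (card Y) * (\<delta> / 2 * G)"
    using assms by (intro mult_right_mono) (auto intro: card_mono)
  finally have "\<delta> / 2 * real (card Y) * G \<le> real (card ?L) * G"
    using assms(5) by (simp add: field_simps)
  then show ?thesis using \<open>0 < G\<close> by simp
qed

lemma sum_of_bool_words: "(\<Sum>w\<in>words K n. of_bool (P w)) = real (card {w \<in> words K n. P w})"
  by (simp add: Int_def)

lemma card_words_le: "real (card {w \<in> words K n. P w}) \<le> real K ^ n"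
  using card_mono[of "words K n" "{w \<in> words K n. P w}"] by (simp flip: of_nat_power)

definition line_template :: "nat \<Rightarrow> nat list \<Rightarrow> (nat + nat) list" where
  "line_template K z = map (\<lambda>a. if a = K then Inr 0 else Inl a) z"

lemma fill_line_template [simp]: "fill (line_template K z) (a # w) = sub K a z"
  by (auto simp: fill_def line_template_def sub_def)

lemma line_template_shift_templates:
  assumes "z \<in> words (Suc K) l" "K \<in> set z" "v \<in> templates K m n"
  shows "line_template K z @ shift v \<in> templates K (Suc m) (l + n)"
proof (rule append_shift_templates[OF assms(3)])
  show "set (line_template K z) \<subseteq> Inl ` {..<K} \<union> {Inr 0}" "Inr 0 \<in> set (line_template K z)"
    using assms(1,2) by (auto simp: line_template_def words_def less_Suc_eq image_iff)
  show "length (line_template K z) = l" using assms(1) by (simp add: line_template_def words_def)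
qed

text \<open>Many suffixes have a dense section of length \<open>N1\<close>, which contains a line.
  There are only \<open>Suc K ^ N1\<close> words encoding lines, so one line \<open>z\<close> is
  shared by a set of suffixes of density \<open>\<theta>\<close>; the induction hypothesis supplies
  the other \<open>m\<close> variables there.\<close>

lemma dhj_subspace:
  assumes "dhj K" "K \<ge> 1" "0 < \<delta>"
  shows "\<exists>N. \<forall>n\<ge>N. \<forall>D\<subseteq>words K n. \<delta> * real K ^ n \<le> real (card D) \<longrightarrow>
    (\<exists>v\<in>templates K m n. \<forall>w\<in>words K m. fill v w \<in> D)"
  using assms(3)
proof (induction m arbitrary: \<delta>)
  case 0
  have "\<exists>v\<in>templates K 0 n. \<forall>w\<in>words K 0. fill v w \<in> D"
    if D: "D \<subseteq> words K n" "\<delta> * real K ^ n \<le> real (card D)" for n D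
  proof -
    have "0 < \<delta> * real K ^ n" using \<open>0 < \<delta>\<close> \<open>K \<ge> 1\<close> by simp
    then have "0 < card D" using D(2) by linarith
    then obtain d where "d \<in> D" by fastforce
    then show ?thesis
      using D(1) map_Inl_templates by (intro bexI[of _ "map Inl d"]) auto
  qed
  then show ?case by blast
next
  case (Suc m)
  obtain N1 where N1: "\<And>D. D \<subseteq> words K N1 \<Longrightarrow> \<delta> / 2 * real K ^ N1 \<le> real (card D) \<Longrightarrow> contains_line K N1 D"
    using assms(1) \<open>0 < \<delta>\<close> unfolding dhj_def by (metis half_gt_zero order_refl)
  define \<theta> where "\<theta> = \<delta> / 2 / real (Suc K) ^ N1"
  have "0 < \<theta>" using \<open>0 < \<delta>\<close> by (simp add: \<theta>_def)
  from Suc.IH[OF this] obtain N2 where N2: "\<And>n D. n \<ge> N2 \<Longrightarrow> D \<subseteq> words K n \<Longrightarrow>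
      \<theta> * real K ^ n \<le> real (card D) \<Longrightarrow> \<exists>v\<in>templates K m n. \<forall>w\<in>words K m. fill v w \<in> D"
    by blast
  have "\<exists>v\<in>templates K (Suc m) n. \<forall>w\<in>words K (Suc m). fill v w \<in> D"
    if n: "N1 + N2 \<le> n" and D: "D \<subseteq> words K n" "\<delta> * real K ^ n \<le> real (card D)" for n D
  proof -
    define n2 where "n2 = n - N1"
    have n2: "n = N1 + n2" "N2 \<le> n2" using n by (auto simp: n2_def)
    define Y where "Y = {y \<in> words K n2. \<delta> / 2 * real K ^ N1 \<le> real (card {u \<in> words K N1. u @ y \<in> D})}"
    have "real (card D) = (\<Sum>w\<in>words K n. of_bool (w \<in> D))"
      using D(1) unfolding sum_of_bool_words by (simp add: Collect_conj_eq Int_absorb1)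
    also have "\<dots> = (\<Sum>y\<in>words K n2. \<Sum>u\<in>words K N1. of_bool (u @ y \<in> D))"
      unfolding n2(1) sum_words_append by (rule sum.swap)
    also have "\<dots> = (\<Sum>y\<in>words K n2. real (card {u \<in> words K N1. u @ y \<in> D}))"
      unfolding sum_of_bool_words ..
    finally have "\<delta> / 2 * real (card (words K n2)) \<le> real (card Y)"
      unfolding Y_def using D(2) \<open>0 < \<delta>\<close> \<open>K \<ge> 1\<close>
      by (intro many_large card_words_le) (auto simp: n2(1) power_add mult_ac)
    then have Y: "\<delta> / 2 * real K ^ n2 \<le> real (card Y)" by simp
    have "\<exists>z\<in>words (Suc K) N1. K \<in> set z \<and> (\<forall>i<K. sub K i z @ y \<in> D)" if "y \<in> Y" for y
      using N1[of "{u \<in> words K N1. u @ y \<in> D}"] that by (auto simp: Y_def contains_line_def)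
    then obtain Z where Z: "\<And>y. y \<in> Y \<Longrightarrow> Z y \<in> words (Suc K) N1 \<and> K \<in> set (Z y) \<and> (\<forall>i<K. sub K i (Z y) @ y \<in> D)"
      by metis
    have "finite Y" by (simp add: Y_def)
    moreover have "words (Suc K) N1 \<noteq> {}"
      by (metis card.empty card_words nat.distinct(1) power_not_zero)
    ultimately obtain z where z: "z \<in> words (Suc K) N1" "card Y \<le> card (Z -` {z} \<inter> Y) * Suc K ^ N1"
      using pigeonhole_card[of Z Y "words (Suc K) N1"] Z by auto
    define Y' where "Y' = Z -` {z} \<inter> Y"
    have "real (card Y) \<le> real (card Y' * Suc K ^ N1)"
      using z(2) unfolding Y'_def of_nat_le_iff .
    then have "\<delta> / 2 * real K ^ n2 \<le> real (card Y') * real (Suc K) ^ N1"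
      using Y by simp
    then have Y': "\<theta> * real K ^ n2 \<le> real (card Y')"
      by (simp add: \<theta>_def divide_simps mult_ac)
    moreover have "0 < \<theta> * real K ^ n2" using \<open>0 < \<theta>\<close> \<open>K \<ge> 1\<close> by simp
    ultimately have "0 < card Y'" by linarith
    then obtain y0 where "y0 \<in> Y'" by fastforce
    then have Kz: "K \<in> set z" using Z by (auto simp: Y'_def)
    have "Y' \<subseteq> words K n2" by (auto simp: Y'_def Y_def)
    then obtain v where v: "v \<in> templates K m n2" "\<And>w. w \<in> words K m \<Longrightarrow> fill v w \<in> Y'"
      using N2[OF n2(2) _ Y'] by blast
    have "fill (line_template K z @ shift v) w \<in> D" if w: "w \<in> words K (Suc m)" for w
    proof -
      obtain a w' where w': "w = a # w'" using w by (cases w) (auto simp: words_def)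
      then have "fill v w' \<in> Y'" "a < K" using w v(2) by auto
      then show ?thesis using Z by (auto simp: w' fill_append Y'_def)
    qed
    then show ?thesis
      using line_template_shift_templates[OF z(1) Kz v(1)] n2(1) by blast
  qed
  then show ?case by blast
qed

section \<open>Sets that do not distinguish the letters \<open>i\<close> and
  \<open>K\<close>\<close>

definition insensitive :: "nat \<Rightarrow> nat \<Rightarrow> nat \<Rightarrow> nat list set \<Rightarrow> bool" where
  "insensitive K i n C \<longleftrightarrow> (\<forall>w\<in>words (Suc K) n. sub K i w \<in> C \<longleftrightarrow> w \<in> C)"

text \<open>\<open>free_coordinates\<close> finds an \<open>M\<close>-dimensional subspace in which
  \<open>C\<close> is dense among the words over \<open>{..<K}\<close>, and
  \<open>dhj_subspace\<close> an \<open>m\<close>-dimensional one inside whose words over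
  \<open>{..<K}\<close> all lie in \<open>C\<close>. Insensitivity then admits the letter
  \<open>K\<close>, since it may be replaced by \<open>i\<close>.\<close>

lemma insensitive_subspace:
  assumes "dhj K" "i < K" "0 < \<epsilon>"
  shows "\<exists>N. \<forall>n\<ge>N. \<forall>C\<subseteq>words (Suc K) n. insensitive K i n C \<longrightarrow> \<epsilon> * real (Suc K) ^ n \<le> real (card C) \<longrightarrow>
    (\<exists>v\<in>templates (Suc K) m n. \<forall>w\<in>words (Suc K) m. fill v w \<in> C)"
proof -
  have "1 \<le> K" "0 < \<epsilon> / 2" using assms by auto
  from dhj_subspace[OF assms(1) this] obtain M where M: "\<And>D. D \<subseteq> words K M \<Longrightarrow>
      \<epsilon> / 2 * real K ^ M \<le> real (card D) \<Longrightarrow> \<exists>v\<in>templates K m M. \<forall>w\<in>words K m. fill v w \<in> D"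
    by (meson order_refl)
  have "\<exists>N. \<forall>n\<ge>N. \<forall>f. (\<forall>w\<in>words (Suc K) n. f w \<le> 1) \<longrightarrow> \<epsilon> * real (Suc K) ^ n \<le> (\<Sum>w\<in>words (Suc K) n. f w) \<longrightarrow>
    (\<exists>v\<in>templates (Suc K) M n. \<epsilon> / 2 * real K ^ M \<le> (\<Sum>w\<in>words K M. f (fill v w)))"
    using \<open>1 \<le> K\<close> assms free_coordinates[of "\<lambda>x. x" K "Suc K" \<epsilon> M] by simp
  then obtain N where N: "\<And>n f. n \<ge> N \<Longrightarrow> (\<And>w. w \<in> words (Suc K) n \<Longrightarrow> f w \<le> 1) \<Longrightarrow>
      \<epsilon> * real (Suc K) ^ n \<le> (\<Sum>w\<in>words (Suc K) n. f w) \<Longrightarrow>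
      \<exists>v\<in>templates (Suc K) M n. \<epsilon> / 2 * real K ^ M \<le> (\<Sum>w\<in>words K M. f (fill v w))"
    by meson
  have "\<exists>v\<in>templates (Suc K) m n. \<forall>w\<in>words (Suc K) m. fill v w \<in> C"
    if "N \<le> n" and C: "C \<subseteq> words (Suc K) n" "insensitive K i n C" "\<epsilon> * real (Suc K) ^ n \<le> real (card C)" for n C
  proof -
    have "real (card C) = (\<Sum>w\<in>words (Suc K) n. of_bool (w \<in> C))"
      using C(1) unfolding sum_of_bool_words by (simp add: Collect_conj_eq Int_absorb1)
    then obtain v1 where v1: "v1 \<in> templates (Suc K) M n"
      "\<epsilon> / 2 * real K ^ M \<le> (\<Sum>w\<in>words K M. of_bool (fill v1 w \<in> C))"
      using N[OF \<open>N \<le> n\<close>, of "\<lambda>w. of_bool (w \<in> C)"] C(3) by auto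
    define D where "D = {w \<in> words K M. fill v1 w \<in> C}"
    have "\<epsilon> / 2 * real K ^ M \<le> real (card D)"
      using v1(2) unfolding sum_of_bool_words D_def .
    then obtain v2 where v2: "v2 \<in> templates K m M" "\<And>w. w \<in> words K m \<Longrightarrow> fill v2 w \<in> D"
      using M[of D] by (auto simp: D_def)
    have v2': "v2 \<in> templates (Suc K) m M"
      using v2(1) templates_mono[of K "Suc K"] by auto
    have "fill (template_comp v1 v2) w \<in> C" if w: "w \<in> words (Suc K) m" for w
    proof -
      have len: "length w = m" "length v2 = M" using w v2(1) by (auto simp: words_def templates_def)
      have fw: "fill v2 w \<in> words (Suc K) M" using fill_in_words[OF v2' w] by simp
      have "fill v2 (sub K i w) \<in> D" using sub_in_words[OF w] v2(2) \<open>i < K\<close> by auto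
      then have "fill v1 (sub K i (fill v2 w)) \<in> C"
        using sub_fill[OF v2(1) len(1)] by (simp add: D_def)
      moreover have "sub K i (fill v2 w) \<in> words (Suc K) M"
        using sub_in_words[OF fw \<open>i < K\<close>] words_mono[of K "Suc K"] by auto
      ultimately have "sub K i (fill v1 (sub K i (fill v2 w))) \<in> C"
        using C(2) fill_in_words[OF v1(1)] unfolding insensitive_def by auto
      then have "sub K i (fill v1 (fill v2 w)) \<in> C"
        using sub_fill_sub[OF v1(1)] fw \<open>i < K\<close> by (simp add: words_def)
      then have "fill v1 (fill v2 w) \<in> C"
        using C(2) fill_in_words[OF v1(1) fw] unfolding insensitive_def by auto
      then show ?thesis using fill_template_comp[OF v1(1) len(2)] by simp
    qed
    then show ?thesis using template_comp_in_templates[OF v1(1) v2'] by blast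
  qed
  then show ?thesis by blast
qed

section \<open>Removing subspaces from intersections of insensitive sets\<close>

lemma inj_on_fill:
  assumes "v \<in> templates C m n"
  shows "inj_on (fill v) (words K m)"
proof (rule inj_onI)
  fix w w' assume w: "w \<in> words K m" "w' \<in> words K m" and eq: "fill v w = fill v w'"
  have "w ! j = w' ! j" if "j < m" for j
  proof -
    have "Inr j \<in> set v" using assms that by (auto simp: templates_def)
    then obtain k where k: "k < length v" "v ! k = Inr j" by (auto simp: in_set_conv_nth)
    have "fill v w ! k = fill v w' ! k" using eq by simp
    then show ?thesis using k by (simp add: fill_def)
  qed
  then show "w = w'" using w by (intro nth_equalityI) (auto simp: words_def)
qed

lemma words_appendE:
  assumes "w \<in> words K (m + n)"
  obtains u v where "w = u @ v" "u \<in> words K m" "v \<in> words K n"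
proof -
  have "w \<in> (\<lambda>(u, v). u @ v) ` (words K m \<times> words K n)"
    using assms bij_betw_imp_surj_on[OF bij_betw_words_append[of K m n]] by simp
  then show ?thesis using that by auto
qed

definition subspace_part :: "nat \<Rightarrow> nat \<Rightarrow> nat \<Rightarrow> real \<Rightarrow> nat list set \<Rightarrow> nat list set" where
  "subspace_part Q m b c S = (if c \<le> real (card S)
     then fill (SOME v. v \<in> templates Q m b \<and> fill v ` words Q m \<subseteq> S) ` words Q m else {})"

text \<open>
  Peel off blocks of \<open>b\<close> letters. As long as \<open>C\<close> is dense, many of its sections along the next block
  contain a subspace. These subspaces contribute nothing positive to the sum and are removed from \<open>C\<close>; since
  the choice of the subspace depends on the section only, the rest of \<open>C\<close> stays insensitive in the
  letters that follow.
\<close>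

lemma sum_le_max_removal:
  fixes f :: "nat list \<Rightarrow> real" and K :: nat
  defines "Q \<equiv> Suc K"
  assumes sub: "\<And>S. S \<subseteq> words Q b \<Longrightarrow> insensitive K i b S \<Longrightarrow> \<epsilon> / 2 * real Q ^ b \<le> real (card S) \<Longrightarrow>
      \<exists>v\<in>templates Q m b. \<forall>w\<in>words Q m. fill v w \<in> S"
    and "0 < \<epsilon>" "i < K"
    and "t * b \<le> n"
    and "\<And>x. x \<in> words Q (s + n) \<Longrightarrow> f x \<le> 1"
    and "\<And>u v. u \<in> words Q s \<Longrightarrow> v \<in> templates Q m n \<Longrightarrow> (\<Sum>w\<in>words Q m. f (u @ fill v w)) \<le> 0"
    and "\<And>u y. u \<in> words Q s \<Longrightarrow> y \<in> words Q n \<Longrightarrow> u @ sub K i y \<in> C \<longleftrightarrow> u @ y \<in> C"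
  shows "(\<Sum>x\<in>words Q (s + n). of_bool (x \<in> C) * f x)
    \<le> max (\<epsilon> * real Q ^ (s + n))
        ((\<Sum>x\<in>words Q (s + n). of_bool (x \<in> C)) - real t * (\<epsilon> / 2 / real Q ^ b) * real Q ^ (s + n))"
  \<comment> \<open>The letters already peeled off form a prefix of length \<open>s\<close>.
    Insensitivity is asked only beyond it, since a removal may destroy it inside its own
    block.\<close>
  using assms(5-)
proof (induction t arbitrary: s n f C)
  case 0
  have "(\<Sum>x\<in>words Q (s + n). of_bool (x \<in> C) * f x) \<le> (\<Sum>x\<in>words Q (s + n). of_bool (x \<in> C))"
    using 0(2) by (intro sum_mono) (auto simp: of_bool_def)
  then show ?case by simp
next
  case (Suc t s n f C)
  note f_le = Suc.prems(2) and f_sub = Suc.prems(3) and C_ins = Suc.prems(4)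
  define n' where "n' = n - b"
  have n: "n = b + n'" "t * b \<le> n'" using Suc.prems(1) by (auto simp: n'_def)
  have len: "s + n = (s + b) + n'" by (simp add: n(1))
  have split: "(\<Sum>x\<in>words Q (s + n). g x) = (\<Sum>u\<in>words Q s. \<Sum>y\<in>words Q n'. \<Sum>p\<in>words Q b. g (u @ p @ y))"
    for g :: "nat list \<Rightarrow> real"
    unfolding n(1) sum_words_append by (intro sum.cong refl sum.swap)
  show ?case
  proof (cases "(\<Sum>x\<in>words Q (s + n). of_bool (x \<in> C)) \<le> \<epsilon> * real Q ^ (s + n)")
    case True
    have "(\<Sum>x\<in>words Q (s + n). of_bool (x \<in> C) * f x) \<le> (\<Sum>x\<in>words Q (s + n). of_bool (x \<in> C))"
      using f_le by (intro sum_mono) (auto simp: of_bool_def)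
    then show ?thesis using True by simp
  next
    case False
    define c where "c = \<epsilon> / 2 * real Q ^ b"
    define sec where "sec u y = {p \<in> words Q b. u @ p @ y \<in> C}" for u y
    define R where "R u y = subspace_part Q m b c (sec u y)" for u y
    have sub_b: "sub K i p \<in> words Q b" if "p \<in> words Q b" for p b
      using sub_in_words[of p K b i] that \<open>i < K\<close> words_mono[of K Q] unfolding Q_def by auto
    have pyQ: "p @ y \<in> words Q n" if "p \<in> words Q b" "y \<in> words Q n'" for p y
      using that by (simp add: n(1) words_def)
    have sec_ins: "insensitive K i b (sec u y)" if "u \<in> words Q s" "y \<in> words Q n'" for u y
      unfolding insensitive_def Q_def[symmetric]
    proof
      fix p assume p: "p \<in> words Q b"
      have "u @ sub K i (sub K i p @ y) \<in> C \<longleftrightarrow> u @ (sub K i p @ y) \<in> C"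
        using pyQ[OF sub_b[OF p] that(2)] by (rule C_ins[OF that(1)])
      moreover have "u @ sub K i (p @ y) \<in> C \<longleftrightarrow> u @ (p @ y) \<in> C"
        using pyQ[OF p that(2)] by (rule C_ins[OF that(1)])
      ultimately show "sub K i p \<in> sec u y \<longleftrightarrow> p \<in> sec u y"
        using p sub_b[OF p] \<open>i < K\<close> by (simp add: sec_def)
    qed
    have sec_sub: "sec u (sub K i y) = sec u y" if "u \<in> words Q s" "y \<in> words Q n'" for u y
    proof -
      have "u @ p @ sub K i y \<in> C \<longleftrightarrow> u @ p @ y \<in> C" if p: "p \<in> words Q b" for p
      proof -
        have "u @ sub K i (p @ sub K i y) \<in> C \<longleftrightarrow> u @ (p @ sub K i y) \<in> C"
          using pyQ[OF p sub_b[OF \<open>y \<in> words Q n'\<close>]] by (rule C_ins[OF \<open>u \<in> words Q s\<close>])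
        moreover have "u @ sub K i (p @ y) \<in> C \<longleftrightarrow> u @ (p @ y) \<in> C"
          using pyQ[OF p \<open>y \<in> words Q n'\<close>] by (rule C_ins[OF \<open>u \<in> words Q s\<close>])
        ultimately show ?thesis using \<open>i < K\<close> by simp
      qed
      then show ?thesis by (auto simp: sec_def)
    qed
    have R_dense: "\<exists>v\<in>templates Q m b. R u y = fill v ` words Q m \<and> R u y \<subseteq> sec u y"
      if "u \<in> words Q s" "y \<in> words Q n'" "c \<le> real (card (sec u y))" for u y
    proof -
      define v where "v = (SOME v. v \<in> templates Q m b \<and> fill v ` words Q m \<subseteq> sec u y)"
      have "\<exists>v\<in>templates Q m b. \<forall>w\<in>words Q m. fill v w \<in> sec u y"
        using that sec_ins by (intro sub) (auto simp: sec_def c_def)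
      then have "\<exists>v. v \<in> templates Q m b \<and> fill v ` words Q m \<subseteq> sec u y" by blast
      from someI_ex[OF this] have "v \<in> templates Q m b \<and> fill v ` words Q m \<subseteq> sec u y"
        unfolding v_def .
      moreover have "R u y = fill v ` words Q m"
        using that(3) by (simp add: R_def subspace_part_def v_def)
      ultimately show ?thesis by blast
    qed
    have R_sparse: "R u y = {}" if "\<not> c \<le> real (card (sec u y))" for u y
      using that by (simp add: R_def subspace_part_def)
    have R_sec: "R u y \<subseteq> sec u y" if "u \<in> words Q s" "y \<in> words Q n'" for u y
      using R_dense[OF that] R_sparse by blast
    define C' where "C' = {x \<in> C. take b (drop s x) \<notin> R (take s x) (drop (s + b) x)}"
    have C': "u @ p @ y \<in> C' \<longleftrightarrow> u @ p @ y \<in> C \<and> p \<notin> R u y"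
      if "u \<in> words Q s" "p \<in> words Q b" for u p y
      using that by (simp add: C'_def words_def)
    have ind: "of_bool (u @ p @ y \<in> C) = (of_bool (u @ p @ y \<in> C') + of_bool (p \<in> R u y) :: real)"
      if "u \<in> words Q s" "p \<in> words Q b" "y \<in> words Q n'" for u p y
      using R_sec[OF that(1,3)] C'[OF that(1,2)] by (auto simp: sec_def of_bool_def)
    have R_f: "(\<Sum>p\<in>words Q b. of_bool (p \<in> R u y) * f (u @ p @ y)) \<le> 0"
      if u: "u \<in> words Q s" and y: "y \<in> words Q n'" for u y
    proof (cases "c \<le> real (card (sec u y))")
      case True
      then obtain v where v: "v \<in> templates Q m b" "R u y = fill v ` words Q m" "R u y \<subseteq> sec u y"
        using R_dense[OF u y] by blast
      have "(\<Sum>p\<in>words Q b. of_bool (p \<in> R u y) * f (u @ p @ y)) = (\<Sum>p\<in>R u y. f (u @ p @ y))"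
        using v(3) by (intro sum.mono_neutral_cong_right) (auto simp: sec_def)
      also have "\<dots> = (\<Sum>w\<in>words Q m. f (u @ fill (v @ map Inl y) w))"
        unfolding v(2) by (simp add: sum.reindex[OF inj_on_fill[OF v(1)]] fill_append)
      also have "\<dots> \<le> 0"
        using append_map_Inl_templates[OF v(1) y] unfolding n(1)[symmetric] by (rule f_sub[OF u])
      finally show ?thesis .
    qed (simp add: R_sparse)
    have C'_eq: "(\<Sum>x\<in>words Q (s + n). of_bool (x \<in> C) * g x) = (\<Sum>x\<in>words Q (s + n). of_bool (x \<in> C') * g x) +
        (\<Sum>u\<in>words Q s. \<Sum>y\<in>words Q n'. \<Sum>p\<in>words Q b. of_bool (p \<in> R u y) * g (u @ p @ y))"
      for g :: "nat list \<Rightarrow> real"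
      unfolding split by (simp add: ind distrib_right sum.distrib)
    \<comment> \<open>At least a fraction \<open>\<epsilon> / 2\<close> of the pairs of
      \<open>u\<close> and \<open>y\<close> has a dense section, and each such section loses at
      least one word out of \<open>Q ^ b\<close>.\<close>
    have R_count: "\<epsilon> / 2 / real Q ^ b * real Q ^ (s + n)
        \<le> (\<Sum>u\<in>words Q s. \<Sum>y\<in>words Q n'. \<Sum>p\<in>words Q b. of_bool (p \<in> R u y))"
    proof -
      let ?U = "words Q s \<times> words Q n'"
      have "\<epsilon> / 2 * real (card ?U) \<le> real (card {z \<in> ?U. \<epsilon> / 2 * real Q ^ b \<le> real (card (sec (fst z) (snd z)))})"
      proof (rule many_large)
        have "\<epsilon> * real Q ^ (s + n) \<le> (\<Sum>x\<in>words Q (s + n). of_bool (x \<in> C))" using False by simp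
        also have "\<dots> = (\<Sum>z\<in>?U. real (card (sec (fst z) (snd z))))"
          unfolding split unfolding sum_of_bool_words sec_def by (simp add: sum.cartesian_product case_prod_unfold)
        finally show "\<epsilon> * real (card ?U) * real Q ^ b \<le> (\<Sum>z\<in>?U. real (card (sec (fst z) (snd z))))"
          by (simp add: card_cartesian_product n(1) power_add mult_ac)
        show "real (card (sec (fst z) (snd z))) \<le> real Q ^ b" for z
          unfolding sec_def by (rule card_words_le)
      qed (use \<open>0 < \<epsilon>\<close> in \<open>auto simp: Q_def\<close>)
      also have "\<dots> = (\<Sum>z\<in>?U. of_bool (c \<le> real (card (sec (fst z) (snd z)))))"
        by (simp add: Int_def c_def)
      also have "\<dots> \<le> (\<Sum>z\<in>?U. \<Sum>p\<in>words Q b. of_bool (p \<in> R (fst z) (snd z)))"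
      proof (intro sum_mono)
        fix z assume "z \<in> ?U"
        then have z: "fst z \<in> words Q s" "snd z \<in> words Q n'" by auto
        have "1 \<le> card (R (fst z) (snd z))" if large: "c \<le> real (card (sec (fst z) (snd z)))"
        proof -
          obtain v where v: "v \<in> templates Q m b" "R (fst z) (snd z) = fill v ` words Q m"
            using R_dense[OF z large] by blast
          then show ?thesis by (simp add: card_image[OF inj_on_fill[OF v(1)]] Q_def)
        qed
        moreover have "{p \<in> words Q b. p \<in> R (fst z) (snd z)} = R (fst z) (snd z)"
          using R_sec[OF z] by (auto simp: sec_def)
        ultimately show "of_bool (c \<le> real (card (sec (fst z) (snd z)))) \<le> (\<Sum>p\<in>words Q b. of_bool (p \<in> R (fst z) (snd z)) :: real)"
          unfolding sum_of_bool_words by (simp add: of_bool_def)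
      qed
      finally have "\<epsilon> / 2 * real (card ?U) \<le> (\<Sum>z\<in>?U. \<Sum>p\<in>words Q b. of_bool (p \<in> R (fst z) (snd z)))" .
      moreover have "\<epsilon> / 2 / real Q ^ b * real Q ^ (s + n) = \<epsilon> / 2 * real (card ?U)"
        by (simp add: card_cartesian_product n(1) power_add Q_def)
      ultimately show ?thesis
        by (simp add: sum.cartesian_product case_prod_unfold)
    qed
    have "(\<Sum>x\<in>words Q (s + n). of_bool (x \<in> C) * f x) \<le> (\<Sum>x\<in>words Q (s + n). of_bool (x \<in> C') * f x)"
      unfolding C'_eq using R_f by (simp add: sum_nonpos)
    also have "\<dots> \<le> max (\<epsilon> * real Q ^ (s + n))
        ((\<Sum>x\<in>words Q (s + n). of_bool (x \<in> C')) - real t * (\<epsilon> / 2 / real Q ^ b) * real Q ^ (s + n))"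
      unfolding len
    proof (rule Suc.IH[OF n(2)])
      show "f x \<le> 1" if "x \<in> words Q (s + b + n')" for x
        using that f_le by (simp add: len)
    next
      fix u v assume u: "u \<in> words Q (s + b)" and v: "v \<in> templates Q m n'"
      obtain u' p where u': "u = u' @ p" "u' \<in> words Q s" "p \<in> words Q b"
        using u by (rule words_appendE)
      have "map Inl p @ v \<in> templates Q m n"
        unfolding n(1) by (rule map_Inl_append_templates[OF v u'(3)])
      from f_sub[OF u'(2) this] show "(\<Sum>w\<in>words Q m. f (u @ fill v w)) \<le> 0"
        by (simp add: u' fill_append)
    next
      fix u y assume u: "u \<in> words Q (s + b)" and y: "y \<in> words Q n'"
      obtain u' p where u': "u = u' @ p" "u' \<in> words Q s" "p \<in> words Q b"
        using u by (rule words_appendE)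
      have "u' @ p @ sub K i y \<in> C \<longleftrightarrow> u' @ p @ y \<in> C"
        using sec_sub[OF u'(2) y] u'(3) by (auto simp: sec_def)
      then show "u @ sub K i y \<in> C' \<longleftrightarrow> u @ y \<in> C'"
        using C'[OF u'(2,3)] sec_sub[OF u'(2) y] by (simp add: u'(1) R_def)
    qed
    also have "\<dots> \<le> max (\<epsilon> * real Q ^ (s + n))
        ((\<Sum>x\<in>words Q (s + n). of_bool (x \<in> C)) - real (Suc t) * (\<epsilon> / 2 / real Q ^ b) * real Q ^ (s + n))"
      using C'_eq[of "\<lambda>_. 1"] R_count by (intro max.mono) (auto simp: algebra_simps add_divide_distrib)
    finally show ?thesis .
  qed
qed

text \<open>Read \<open>f\<close> as the indicator of a set minus a density that the set does not
  exceed on any \<open>m\<close>-dimensional subspace; then its excess on an intersection of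
  insensitive sets is at most \<open>\<epsilon>\<close>. General functions \<open>f \<le> 1\<close>
  are allowed because the induction on \<open>J\<close> feeds in products with indicators.\<close>

definition insensitive_sums_bounded :: "nat \<Rightarrow> nat set \<Rightarrow> nat \<Rightarrow> nat \<Rightarrow> real \<Rightarrow> bool" where
  "insensitive_sums_bounded K J m n \<epsilon> \<longleftrightarrow> (\<forall>f C. (\<forall>x\<in>words (Suc K) n. f x \<le> (1 :: real)) \<longrightarrow>
    (\<forall>v\<in>templates (Suc K) m n. (\<Sum>w\<in>words (Suc K) m. f (fill v w)) \<le> 0) \<longrightarrow> (\<forall>j\<in>J. insensitive K j n (C j)) \<longrightarrow>
    (\<Sum>x\<in>words (Suc K) n. of_bool (\<forall>j\<in>J. x \<in> C j) * f x) \<le> \<epsilon> * real (Suc K) ^ n)"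

lemma insensitive_sums_bounded_singleton:
  assumes "dhj K" "i < K" "0 < \<epsilon>"
  shows "\<exists>N. \<forall>n\<ge>N. insensitive_sums_bounded K {i} m n \<epsilon>"
proof -
  have "0 < \<epsilon> / 2" using assms by simp
  from insensitive_subspace[OF assms(1,2) this] obtain b where b: "\<And>S. S \<subseteq> words (Suc K) b \<Longrightarrow> insensitive K i b S \<Longrightarrow>
      \<epsilon> / 2 * real (Suc K) ^ b \<le> real (card S) \<Longrightarrow> \<exists>v\<in>templates (Suc K) m b. \<forall>w\<in>words (Suc K) m. fill v w \<in> S"
    by (meson order_refl)
  define \<theta> where "\<theta> = \<epsilon> / 2 / real (Suc K) ^ b"
  have "0 < \<theta>" using \<open>0 < \<epsilon>\<close> by (simp add: \<theta>_def)
  \<comment> \<open>Each removal takes away a proportion of at least \<open>\<theta>\<close> of all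
    words, so \<open>t\<close> of them would exhaust everything; the set must become sparse
    before.\<close>
  then obtain t where "1 < real t * \<theta>" using reals_Archimedean3 by blast
  then have t: "1 - real t * \<theta> \<le> \<epsilon>" using \<open>0 < \<epsilon>\<close> by linarith
  have "(\<Sum>x\<in>words (Suc K) n. of_bool (x \<in> C) * f x) \<le> \<epsilon> * real (Suc K) ^ n"
    if "t * b \<le> n" and f: "\<forall>x\<in>words (Suc K) n. f x \<le> (1 :: real)"
      "\<forall>v\<in>templates (Suc K) m n. (\<Sum>w\<in>words (Suc K) m. f (fill v w)) \<le> 0" "insensitive K i n C"
    for n and f :: "nat list \<Rightarrow> real" and C
  proof -
    have "(\<Sum>x\<in>words (Suc K) (0 + n). of_bool (x \<in> C) * f x) \<le> max (\<epsilon> * real (Suc K) ^ (0 + n))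
        ((\<Sum>x\<in>words (Suc K) (0 + n). of_bool (x \<in> C)) - real t * (\<epsilon> / 2 / real (Suc K) ^ b) * real (Suc K) ^ (0 + n))"
      by (rule sum_le_max_removal[where m = m and i = i])
        (use b assms \<open>t * b \<le> n\<close> f in \<open>auto simp: insensitive_def\<close>)
    also have "\<dots> \<le> \<epsilon> * real (Suc K) ^ n"
    proof -
      have "(\<Sum>x\<in>words (Suc K) n. of_bool (x \<in> C)) - real t * \<theta> * real (Suc K) ^ n \<le>
          (1 - real t * \<theta>) * real (Suc K) ^ n"
        unfolding sum_of_bool_words using card_words_le[of "Suc K" n "\<lambda>x. x \<in> C"] by (simp add: algebra_simps)
      also have "\<dots> \<le> \<epsilon> * real (Suc K) ^ n"
        using t by (rule mult_right_mono) simp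
      finally show ?thesis by (simp add: \<theta>_def)
    qed
    finally show ?thesis by simp
  qed
  then show ?thesis
    unfolding insensitive_sums_bounded_def ball_simps by (intro exI[of _ "t * b"]) (simp del: of_nat_Suc)
qed

lemma insensitive_vimage:
  assumes "v \<in> templates (Suc K) m n" "insensitive K i n C" "i < K"
  shows "insensitive K i m {w. fill v w \<in> C}"
  unfolding insensitive_def
proof
  fix w assume w: "w \<in> words (Suc K) m"
  then have "sub K i w \<in> words (Suc K) m"
    using sub_in_words[OF w \<open>i < K\<close>] words_mono[of K "Suc K"] by auto
  then have "fill v (sub K i w) \<in> C \<longleftrightarrow> sub K i (fill v (sub K i w)) \<in> C"
    using assms(2) fill_in_words[OF assms(1)] unfolding insensitive_def by auto
  also have "\<dots> \<longleftrightarrow> sub K i (fill v w) \<in> C"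
    using sub_fill_sub[OF assms(1), of w i K] w assms(3) by (simp add: words_def)
  also have "\<dots> \<longleftrightarrow> fill v w \<in> C"
    using assms(2) fill_in_words[OF assms(1) w] unfolding insensitive_def by auto
  finally show "sub K i w \<in> {w. fill v w \<in> C} \<longleftrightarrow> w \<in> {w. fill v w \<in> C}" by simp
qed

text \<open>For \<open>insert j J\<close>, the induction hypothesis bounds the sum over the
  intersection for \<open>J\<close> on every \<open>M\<close>-dimensional subspace. Subtracting
  \<open>\<epsilon> / 2\<close> makes these sums nonpositive, so the singleton case applies to
  \<open>C j\<close> with \<open>M\<close> in place of \<open>m\<close>.\<close>

lemma insensitive_sums_bounded:
  assumes "dhj K" "1 \<le> K" "0 < \<epsilon>" "finite J" "J \<subseteq> {..<K}"
  shows "\<exists>N. \<forall>n\<ge>N. insensitive_sums_bounded K J m n \<epsilon>"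
  using assms(4,5,3)
proof (induction J arbitrary: \<epsilon> rule: finite_induct)
  case empty
  \<comment> \<open>The whole space is insensitive, so the empty intersection is a special case of a
    singleton.\<close>
  have "insensitive_sums_bounded K {} m n \<epsilon>" if "insensitive_sums_bounded K {0} m n \<epsilon>" for n
    unfolding insensitive_sums_bounded_def
  proof (intro allI impI)
    fix f and C :: "nat \<Rightarrow> nat list set"
    assume "\<forall>x\<in>words (Suc K) n. f x \<le> (1 :: real)" "\<forall>v\<in>templates (Suc K) m n. (\<Sum>w\<in>words (Suc K) m. f (fill v w)) \<le> 0"
    then show "(\<Sum>x\<in>words (Suc K) n. of_bool (\<forall>j\<in>{}. x \<in> C j) * f x) \<le> \<epsilon> * real (Suc K) ^ n"
      using that[unfolded insensitive_sums_bounded_def, rule_format, of f "\<lambda>_. UNIV"]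
      by (simp add: insensitive_def)
  qed
  then show ?case
    using insensitive_sums_bounded_singleton[OF assms(1), of 0 \<epsilon> m] \<open>1 \<le> K\<close> empty by fastforce
next
  case (insert j J)
  have j: "j < K" "0 < \<epsilon> / 2" and J: "J \<subseteq> {..<K}" using insert.prems by auto
  from insert.IH[OF J j(2)] obtain M where "insensitive_sums_bounded K J m M (\<epsilon> / 2)"
    by blast
  note M = this[unfolded insensitive_sums_bounded_def, rule_format]
  from insensitive_sums_bounded_singleton[OF assms(1) j]
  obtain N where N: "\<And>n. n \<ge> N \<Longrightarrow> insensitive_sums_bounded K {j} M n (\<epsilon> / 2)"
    by blast
  have "(\<Sum>x\<in>words (Suc K) n. of_bool (\<forall>j\<in>insert j J. x \<in> C j) * f x) \<le> \<epsilon> * real (Suc K) ^ n"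
    if "N \<le> n" and f: "\<forall>x\<in>words (Suc K) n. f x \<le> (1 :: real)"
      "\<forall>v\<in>templates (Suc K) m n. (\<Sum>w\<in>words (Suc K) m. f (fill v w)) \<le> 0"
      and C: "\<forall>j\<in>insert j J. insensitive K j n (C j)" for n f and C :: "nat \<Rightarrow> nat list set"
  proof -
    define g where "g x = of_bool (\<forall>j\<in>J. x \<in> C j) * f x - \<epsilon> / 2" for x
    have g: "(\<Sum>w\<in>words (Suc K) M. g (fill v w)) \<le> 0" if v: "v \<in> templates (Suc K) M n" for v
    proof -
      have "(\<Sum>w\<in>words (Suc K) M. of_bool (\<forall>j\<in>J. w \<in> {w. fill v w \<in> C j}) * f (fill v w)) \<le> \<epsilon> / 2 * real (Suc K) ^ M"
      proof (rule M)
        show "f (fill v x) \<le> 1" if "x \<in> words (Suc K) M" for x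
          using f(1) fill_in_words[OF v that] by simp
        show "(\<Sum>w\<in>words (Suc K) m. f (fill v (fill u w))) \<le> 0" if u: "u \<in> templates (Suc K) m M" for u
        proof -
          have "length u = M" using u by (simp add: templates_def)
          then show ?thesis
            using f(2) template_comp_in_templates[OF v u] by (auto simp: fill_template_comp[OF v])
        qed
        show "insensitive K j M {w. fill v w \<in> C j}" if "j \<in> J" for j
          using C J that by (intro insensitive_vimage[OF v]) auto
      qed
      then show ?thesis by (simp add: g_def sum_subtractf mult_ac)
    qed
    have "g x \<le> 1" if "x \<in> words (Suc K) n" for x
      using f(1) that j(2) by (auto simp: g_def of_bool_def intro: order_trans[of _ "f x"])
    then have "(\<Sum>x\<in>words (Suc K) n. of_bool (x \<in> C j) * g x) \<le> \<epsilon> / 2 * real (Suc K) ^ n"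
      using N[OF \<open>N \<le> n\<close>, unfolded insensitive_sums_bounded_def, rule_format, of g C] g C by simp
    moreover have "(\<Sum>x\<in>words (Suc K) n. of_bool (\<forall>j\<in>insert j J. x \<in> C j) * f x)
        = (\<Sum>x\<in>words (Suc K) n. of_bool (x \<in> C j) * g x) + \<epsilon> / 2 * (\<Sum>x\<in>words (Suc K) n. of_bool (x \<in> C j))"
      unfolding sum_distrib_left sum.distrib[symmetric] g_def
      by (intro sum.cong refl) (auto simp: of_bool_def)
    moreover have "\<epsilon> / 2 * (\<Sum>x\<in>words (Suc K) n. of_bool (x \<in> C j)) \<le> \<epsilon> / 2 * real (Suc K) ^ n"
      unfolding sum_of_bool_words using j(2) by (intro mult_left_mono card_words_le) simp
    ultimately show ?thesis by linarith
  qed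
  then show ?case unfolding insensitive_sums_bounded_def by blast
qed

section \<open>The density Hales-Jewett theorem\<close>

lemma map_in_words:
  assumes "w \<in> words K n" "\<And>a. a < K \<Longrightarrow> f a < L"
  shows "map f w \<in> words L n"
  using assms by (auto simp: words_def subset_iff)

text \<open>
  In \<open>b\<close> a letter \<open>K + l\<close> stands for a copy of the \<open>l\<close>-th letter of \<open>z\<close>, so that for every \<open>b\<close> the words
  \<open>z @ plug K z b\<close> form a subspace parametrised by \<open>z\<close>, to which the induction hypothesis applies.
\<close>

definition plug :: "nat \<Rightarrow> nat list \<Rightarrow> nat list \<Rightarrow> nat list" where
  "plug K z b = map (\<lambda>c. if c < K then c else z ! (c - K)) b"

lemma plug_in_words:
  assumes "z \<in> words L m" "b \<in> words (K + m) n" "K \<le> L"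
  shows "plug K z b \<in> words L n"
proof -
  have "(if c < K then c else z ! (c - K)) < L" if "c < K + m" for c
    using nth_words[OF assms(1), of "c - K"] that assms(3) by auto
  then show ?thesis unfolding plug_def by (rule map_in_words[OF assms(2)])
qed

lemma plug_sub:
  assumes "b \<in> words (K + length z) n"
  shows "plug K (sub K i z) b = sub K i (plug K z b)"
proof -
  have "c < K + length z" if "c \<in> set b" for c
    using assms that by (auto simp: words_def subset_iff)
  then have "map f z ! (c - K) = f (z ! (c - K))" if "c \<in> set b" "\<not> c < K" for c and f :: "nat \<Rightarrow> nat"
    using that by (intro nth_map) (simp add: less_diff_conv2 add.commute)
  then show ?thesis by (auto simp: plug_def sub_def)
qed

text \<open>For fixed \<open>b\<close> the words \<open>w @ plug K w b\<close> are parametrised by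
  the \<open>m\<close> letters of \<open>w\<close>. By averaging, \<open>W y\<close> is dense for
  many \<open>y\<close> and so contains a line \<open>z\<close>; \<open>plug_sub\<close> lifts its
  points to those of \<open>z @ plug K z b\<close> in \<open>E y\<close>.\<close>

lemma many_lines_through_blocks:
  fixes K M m :: nat and \<alpha> :: real
  defines "Q \<equiv> Suc K"
  assumes lines: "\<And>D. D \<subseteq> words K m \<Longrightarrow> \<alpha> / 2 * real K ^ m \<le> real (card D) \<Longrightarrow> contains_line K m D"
    and "1 \<le> K" "0 < \<alpha>" "b \<in> words (K + m) n" "finite Y"
    and E: "\<And>w. w \<in> words K (m + n) \<Longrightarrow> \<alpha> * real (card Y) \<le> real (card {y \<in> Y. w \<in> E y})"
  shows "\<alpha> / 2 * real (card Y) \<le>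
    (\<Sum>z\<in>{z \<in> words Q m. K \<in> set z}. real (card {y \<in> Y. \<forall>i<K. sub K i (z @ plug K z b) \<in> E y}))"
proof -
  define W where "W y = {w \<in> words K m. w @ plug K w b \<in> E y}" for y
  let ?Z = "{z \<in> words Q m. K \<in> set z}"
  let ?G = "{y \<in> Y. \<alpha> / 2 * real K ^ m \<le> real (card (W y))}"
  have "\<alpha> / 2 * real (card Y) \<le> real (card ?G)"
  proof (rule many_large)
    have "(\<Sum>w\<in>words K m. \<alpha> * real (card Y)) \<le> (\<Sum>w\<in>words K m. real (card {y \<in> Y. w @ plug K w b \<in> E y}))"
    proof (intro sum_mono E)
      fix w assume "w \<in> words K m"
      then show "w @ plug K w b \<in> words K (m + n)"
        using plug_in_words[OF _ \<open>b \<in> words (K + m) n\<close>] by (auto simp: words_def)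
    qed
    also have "\<dots> = (\<Sum>w\<in>words K m. \<Sum>y\<in>Y. of_bool (w @ plug K w b \<in> E y))"
      using \<open>finite Y\<close> by (simp add: Int_def)
    also have "\<dots> = (\<Sum>y\<in>Y. \<Sum>w\<in>words K m. of_bool (w @ plug K w b \<in> E y))" by (rule sum.swap)
    also have "\<dots> = (\<Sum>y\<in>Y. real (card (W y)))"
      unfolding W_def sum_of_bool_words ..
    finally show "\<alpha> * real (card Y) * real K ^ m \<le> (\<Sum>y\<in>Y. real (card (W y)))"
      by (simp add: mult_ac)
    show "real (card (W y)) \<le> real K ^ m" for y unfolding W_def by (rule card_words_le)
  qed (use \<open>finite Y\<close> \<open>1 \<le> K\<close> \<open>0 < \<alpha>\<close> in auto)
  also have "\<dots> \<le> (\<Sum>z\<in>?Z. real (card {y \<in> Y. \<forall>i<K. sub K i (z @ plug K z b) \<in> E y}))"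
  proof -
    have "?G \<subseteq> (\<Union>z\<in>?Z. {y \<in> Y. \<forall>i<K. sub K i (z @ plug K z b) \<in> E y})"
    proof
      fix y assume y: "y \<in> ?G"
      then have "contains_line K m (W y)" by (intro lines) (auto simp: W_def)
      then obtain z where z: "z \<in> words Q m" "K \<in> set z" "\<forall>i<K. sub K i z \<in> W y"
        unfolding contains_line_def Q_def by blast
      have "plug K (sub K i z) b = sub K i (plug K z b)" for i
        using \<open>b \<in> words (K + m) n\<close> z(1) by (intro plug_sub) (simp add: words_def)
      with z show "y \<in> (\<Union>z\<in>?Z. {y \<in> Y. \<forall>i<K. sub K i (z @ plug K z b) \<in> E y})"
        using y by (auto simp: W_def)
    qed
    then have "card ?G \<le> card (\<Union>z\<in>?Z. {y \<in> Y. \<forall>i<K. sub K i (z @ plug K z b) \<in> E y})"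
      using \<open>finite Y\<close> by (intro card_mono) auto
    also have "\<dots> \<le> (\<Sum>z\<in>?Z. card {y \<in> Y. \<forall>i<K. sub K i (z @ plug K z b) \<in> E y})"
      by (intro card_UN_le) auto
    finally show ?thesis by (simp flip: of_nat_sum)
  qed
  finally show ?thesis .
qed

text \<open>A constant of \<open>v\<close> that copies a wildcard of \<open>z\<close> becomes
  variable 0 as well, so that \<open>z\<close> and its copies keep moving together; the variables of
  \<open>v\<close> move up by one.\<close>

definition plug_template :: "nat \<Rightarrow> nat list \<Rightarrow> (nat + nat) list \<Rightarrow> (nat + nat) list" where
  "plug_template K z v = line_template K z @ map (\<lambda>x. case x of
     Inl c \<Rightarrow> if c < K then Inl c else if z ! (c - K) = K then Inr 0 else Inl (z ! (c - K))
   | Inr j \<Rightarrow> Inr (Suc j)) v"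

lemma plug_template_in_templates:
  assumes "z \<in> words (Suc K) m" "K \<in> set z" "v \<in> templates (K + m) M n"
  shows "plug_template K z v \<in> templates K (Suc M) (m + n)"
proof -
  let ?t = "\<lambda>x. case x of
     Inl c \<Rightarrow> if c < K then Inl c else if z ! (c - K) = K then Inr 0 else Inl (z ! (c - K))
   | Inr j \<Rightarrow> Inr (Suc j)"
  have v: "length v = n" "set v \<subseteq> Inl ` {..<K + m} \<union> Inr ` {..<M}" "Inr ` {..<M} \<subseteq> set v"
    using assms(3) by (auto simp: templates_def)
  have lt: "length (line_template K z) = m" "set (line_template K z) \<subseteq> Inl ` {..<K} \<union> Inr ` {..<Suc M}"
    "Inr 0 \<in> set (line_template K z)"
    using assms(1,2) by (auto simp: line_template_def words_def less_Suc_eq image_iff)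
  have "?t x \<in> Inl ` {..<K} \<union> Inr ` {..<Suc M}" if "x \<in> set v" for x
  proof (cases x)
    case (Inl c)
    then have "c < K + m" using that v(2) by auto
    then have "z ! (c - K) < Suc K" if "\<not> c < K"
      using nth_words[OF assms(1), of "c - K"] that by auto
    then show ?thesis using Inl by auto
  next
    case (Inr j)
    then show ?thesis using that v(2) by auto
  qed
  moreover have "Inr (Suc j) \<in> ?t ` set v" if "j < M" for j
    using v(3) that by (intro rev_image_eqI[of "Inr j"]) auto
  moreover have "{..<Suc M} = insert 0 (Suc ` {..<M})" by (rule lessThan_Suc_eq_insert_0)
  ultimately show ?thesis
    using v(1) lt unfolding templates_def plug_template_def by (simp add: image_subset_iff)
qed

text \<open>Filling variable 0 with \<open>K\<close> leaves the wildcards of \<open>z\<close> in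
  place, and \<open>z ! l = K\<close> makes \<open>K + l\<close> stand for one more wildcard. A
  letter \<open>K\<close> in \<open>w\<close> thus merely enlarges the wildcard set of the
  line.\<close>

lemma fill_plug_template:
  assumes "v \<in> templates (K + m) M n" "w \<in> words (Suc K) M" "z ! l = K"
  shows "fill (plug_template K z v) (K # w) =
    z @ plug K z (fill v (map (\<lambda>a. if a < K then a else K + l) w))"
proof -
  have "sub K K z = z" by (auto simp: sub_def intro: map_idI)
  moreover have "case_sum (\<lambda>c. c) ((!) (K # w)) (case x of
       Inl c \<Rightarrow> if c < K then Inl c else if z ! (c - K) = K then Inr 0 else Inl (z ! (c - K))
     | Inr j \<Rightarrow> Inr (Suc j))
    = (\<lambda>c. if c < K then c else z ! (c - K))
        (case_sum (\<lambda>c. c) ((!) (map (\<lambda>a. if a < K then a else K + l) w)) x)" if "x \<in> set v" for x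
  proof (cases x)
    case (Inr j)
    then have "j < M" using that assms(1) by (auto simp: templates_def)
    then have "w ! j < Suc K" "j < length w" using nth_words[OF assms(2)] assms(2) by (auto simp: words_def)
    then show ?thesis using Inr assms(3) by (auto simp: less_Suc_eq)
  qed auto
  ultimately show ?thesis
    unfolding plug_template_def plug_def fill_append fill_line_template
    unfolding fill_def by simp
qed

text \<open>The point is that the proportion gained does not depend on \<open>M\<close>. It starts
  from \<open>\<alpha> / 2\<close> in \<open>many_lines_through_blocks\<close>; fixing one
  \<open>z\<close> costs a factor \<open>Q ^ m\<close>, the free coordinates a factor 2, and keeping
  only the words with \<open>K\<close> in variable 0 a factor \<open>Q\<close>.\<close>

lemma lines_in_template:
  fixes K M m :: nat and \<alpha> :: real
  defines "Q \<equiv> Suc K"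
  assumes lines: "\<And>D. D \<subseteq> words K m \<Longrightarrow> \<alpha> / 2 * real K ^ m \<le> real (card D) \<Longrightarrow> contains_line K m D"
    and "1 \<le> K" "1 \<le> m" "0 < \<alpha>"
  shows "\<exists>n. \<forall>Y E. finite Y \<longrightarrow> Y \<noteq> {} \<longrightarrow>
    (\<forall>w\<in>words K (m + n). \<alpha> * real (card Y) \<le> real (card {y \<in> Y. w \<in> E y})) \<longrightarrow>
    (\<exists>v\<in>templates K (Suc M) (m + n). \<alpha> / (4 * real Q ^ Suc m) * real (card Y) * real Q ^ Suc M \<le>
      (\<Sum>z\<in>words Q (Suc M). real (card {y \<in> Y. \<forall>i<K. fill v (sub K i z) \<in> E y})))"
proof -
  define \<epsilon> where "\<epsilon> = \<alpha> / 2 / real Q ^ m"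
  have "0 < \<epsilon>" using \<open>0 < \<alpha>\<close> by (simp add: \<epsilon>_def Q_def)
  define G where "G l n \<longleftrightarrow> (\<forall>f. (\<forall>w\<in>words (K + m) n. f w \<le> 1) \<longrightarrow>
      \<epsilon> * real (K + m) ^ n \<le> (\<Sum>w\<in>words (K + m) n. f w) \<longrightarrow>
      (\<exists>v\<in>templates (K + m) M n. \<epsilon> / 2 * real Q ^ M \<le>
        (\<Sum>w\<in>words Q M. f (fill v (map (\<lambda>a. if a < K then a else K + l) w)))))" for l n
  have "\<exists>N. \<forall>n\<ge>N. G l n" if "l < m" for l
    unfolding G_def using that \<open>1 \<le> K\<close> \<open>1 \<le> m\<close> \<open>0 < \<epsilon>\<close>
    by (intro free_coordinates) (auto simp: Q_def inj_on_def)
  then have "\<forall>l\<in>{..<m}. \<exists>N. \<forall>n\<ge>N. G l n" by simp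
  from bchoice[OF this] obtain N where N: "\<forall>l\<in>{..<m}. \<forall>n\<ge>N l. G l n" by blast
  \<comment> \<open>The position \<open>l\<close> of a wildcard is known only after \<open>z\<close>
    has been chosen, so \<open>n\<close> has to serve all \<open>l < m\<close>.\<close>
  define n where "n = Max (N ` {..<m})"
  have "N l \<le> n" if "l < m" for l using that by (simp add: n_def)
  then have Gn: "G l n" if "l < m" for l using N that by blast
  have "\<exists>v\<in>templates K (Suc M) (m + n). \<alpha> / (4 * real Q ^ Suc m) * real (card Y) * real Q ^ Suc M \<le>
      (\<Sum>z\<in>words Q (Suc M). real (card {y \<in> Y. \<forall>i<K. fill v (sub K i z) \<in> E y}))"
    if Y: "finite Y" "Y \<noteq> {}"
      and E: "\<forall>w\<in>words K (m + n). \<alpha> * real (card Y) \<le> real (card {y \<in> Y. w \<in> E y})" for Y :: "'b set" and E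
  proof -
    define g where "g z = real (card {y \<in> Y. \<forall>i<K. sub K i z \<in> E y})" for z
    have "0 < card Y" using Y by (simp add: card_gt_0_iff)
    let ?Z = "{z \<in> words Q m. K \<in> set z}"
    have Z0: "replicate m K \<in> ?Z" using \<open>1 \<le> m\<close> by (auto simp: words_def Q_def)
    have "\<exists>z\<in>?Z. \<epsilon> * real (card Y) * real (K + m) ^ n \<le> (\<Sum>b\<in>words (K + m) n. g (z @ plug K z b))"
    proof (rule ccontr)
      assume no: "\<not> ?thesis"
      have "(\<Sum>b\<in>words (K + m) n. \<alpha> / 2 * real (card Y)) \<le> (\<Sum>b\<in>words (K + m) n. \<Sum>z\<in>?Z. g (z @ plug K z b))"
        unfolding g_def Q_def
        by (intro sum_mono many_lines_through_blocks lines) (use \<open>1 \<le> K\<close> \<open>0 < \<alpha>\<close> Y E in auto)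
      also have "\<dots> = (\<Sum>z\<in>?Z. \<Sum>b\<in>words (K + m) n. g (z @ plug K z b))" by (rule sum.swap)
      also have "\<dots> < real (card ?Z) * (\<epsilon> * real (card Y) * real (K + m) ^ n)"
        using no Z0 by (intro sum_bounded_above_strict) (auto simp: card_gt_0_iff not_le)
      also have "\<dots> \<le> real Q ^ m * (\<epsilon> * real (card Y) * real (K + m) ^ n)"
        using \<open>0 < \<epsilon>\<close> by (intro mult_right_mono card_words_le) auto
      also have "\<dots> = (\<Sum>b\<in>words (K + m) n. \<alpha> / 2 * real (card Y))"
        by (simp add: \<epsilon>_def Q_def)
      finally show False by simp
    qed
    then obtain z where z: "z \<in> words Q m" "K \<in> set z"
      "\<epsilon> * real (card Y) * real (K + m) ^ n \<le> (\<Sum>b\<in>words (K + m) n. g (z @ plug K z b))" by blast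
    obtain l where l: "l < m" "z ! l = K" using z(1,2) by (auto simp: in_set_conv_nth words_def)
    let ?\<iota> = "\<lambda>a. if a < K then a else K + l"
    have "\<exists>v\<in>templates (K + m) M n. \<epsilon> / 2 * real Q ^ M \<le>
        (\<Sum>w\<in>words Q M. g (z @ plug K z (fill v (map ?\<iota> w))) / real (card Y))"
    proof (rule Gn[OF l(1), unfolded G_def, rule_format])
      have "g x \<le> real (card Y)" for x
        unfolding g_def using Y by (simp add: card_mono)
      then show "g (z @ plug K z w) / real (card Y) \<le> 1" for w
        using \<open>0 < card Y\<close> by simp
      show "\<epsilon> * real (K + m) ^ n \<le> (\<Sum>w\<in>words (K + m) n. g (z @ plug K z w) / real (card Y))"
        using z(3) \<open>0 < card Y\<close> unfolding sum_divide_distrib[symmetric] by (simp add: pos_le_divide_eq mult_ac)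
    qed
    then obtain v where v: "v \<in> templates (K + m) M n"
      "\<epsilon> / 2 * real Q ^ M \<le> (\<Sum>w\<in>words Q M. g (z @ plug K z (fill v (map ?\<iota> w))) / real (card Y))" by blast
    define V where "V = plug_template K z v"
    have V: "V \<in> templates K (Suc M) (m + n)"
      unfolding V_def using z v by (intro plug_template_in_templates) (auto simp: Q_def)
    have gV: "real (card {y \<in> Y. \<forall>i<K. fill V (sub K i x) \<in> E y}) = g (fill V x)" if "x \<in> words Q (Suc M)" for x
      using sub_fill[OF V] that by (simp add: g_def words_def)
    have "\<alpha> / (4 * real Q ^ Suc m) * real (card Y) * real Q ^ Suc M = (\<epsilon> / 2 * real Q ^ M) * real (card Y)"
      by (simp add: \<epsilon>_def Q_def)
    also have "\<dots> \<le> (\<Sum>w\<in>words Q M. g (z @ plug K z (fill v (map ?\<iota> w))))"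
      using v(2) \<open>0 < card Y\<close> unfolding sum_divide_distrib[symmetric] by (simp add: pos_le_divide_eq)
    also have "\<dots> = (\<Sum>w\<in>words Q M. g (fill V (K # w)))"
      using fill_plug_template[OF v(1) _ l(2)] by (intro sum.cong) (auto simp: V_def Q_def)
    also have "\<dots> \<le> (\<Sum>a<Q. \<Sum>w\<in>words Q M. g (fill V (a # w)))"
      by (rule member_le_sum[where f = "\<lambda>a. \<Sum>w\<in>words Q M. g (fill V (a # w))"]) (auto simp: Q_def g_def intro: sum_nonneg)
    also have "\<dots> = (\<Sum>x\<in>words Q (Suc M). g (fill V x))"
      by (simp add: sum_words_Suc)
    finally show ?thesis using V gV by (intro bexI[of _ V]) auto
  qed
  then show ?thesis by blast
qed

section \<open>The size of a line-free set\<close>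

lemma sum_first_failure:
  fixes K :: nat
  shows "(\<Sum>i<K. of_bool ((\<forall>j<i. P j) \<and> \<not> P i)) = (1 - of_bool (\<forall>i<K. P i) :: real)"
  by (induction K) (auto simp: less_Suc_eq)

lemma sub_sub_Suc: "z \<in> words (Suc K) n \<Longrightarrow> sub (Suc K) i (sub K (Suc K) z) = sub K i z"
proof -
  assume "z \<in> words (Suc K) n"
  then have "a \<noteq> Suc K" if "a \<in> set z" for a using that by (auto simp: words_def subset_iff)
  then show ?thesis by (auto simp: sub_def)
qed

text \<open>In \<open>L\<close> the set \<open>X\<close> has only words without \<open>K\<close>,
  since otherwise \<open>z\<close> and all \<open>sub K i z\<close> would form a line; this costs
  one \<open>\<eta>\<close>. Outside \<open>L\<close>, split by the least \<open>i\<close> with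
  \<open>sub K i z \<notin> X\<close>: each of these \<open>K\<close> pieces is an intersection of
  sets insensitive for the indices \<open>j \<le> i\<close>, where the excess of \<open>X\<close>
  over density \<open>\<beta>\<close> is at most \<open>\<eta>\<close>.\<close>

lemma line_free_card_bound:
  fixes K :: nat and \<beta> \<eta> :: real
  defines "Q \<equiv> Suc K"
  assumes X: "X \<subseteq> words Q n" "\<not> contains_line Q n X"
    and isb: "\<And>i. i < K \<Longrightarrow> insensitive_sums_bounded K {..i} m n \<eta>"
    and X_sub: "\<And>v. v \<in> templates Q m n \<Longrightarrow> real (card {w \<in> words Q m. fill v w \<in> X}) \<le> \<beta> * real Q ^ m"
    and "0 \<le> \<beta>" "real K ^ n \<le> \<eta> * real Q ^ n"
  shows "real (card X) \<le> (1 + real K) * \<eta> * real Q ^ n +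
    \<beta> * (real Q ^ n - real (card {z \<in> words Q n. \<forall>i<K. sub K i z \<in> X}))"
proof -
  define P where "P i z \<longleftrightarrow> sub K i z \<in> X" for i z
  define f where "f z = of_bool (z \<in> X) - \<beta>" for z
  define L where "L = {z \<in> words Q n. \<forall>i<K. sub K i z \<in> X}"
  have part: "(\<Sum>z\<in>words Q n. of_bool ((\<forall>j<i. P j z) \<and> \<not> P i z) * f z) \<le> \<eta> * real Q ^ n" if "i < K" for i
  proof -
    define C where "C j = (if j = i then {z. \<not> P i z} else {z. P j z})" for j
    have "(\<Sum>z\<in>words Q n. of_bool (\<forall>j\<in>{..i}. z \<in> C j) * f z) \<le> \<eta> * real Q ^ n"
      unfolding Q_def
    proof (rule isb[OF that, unfolded insensitive_sums_bounded_def, rule_format])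
      show "f z \<le> 1" for z using \<open>0 \<le> \<beta>\<close> by (simp add: f_def of_bool_def)
      show "(\<Sum>w\<in>words (Suc K) m. f (fill v w)) \<le> 0" if "v \<in> templates (Suc K) m n" for v
        using X_sub that unfolding f_def sum_subtractf sum_of_bool_words by (simp add: Q_def mult.commute)
      show "insensitive K j n (C j)" if "j \<in> {..i}" for j
        using that \<open>i < K\<close> by (auto simp: insensitive_def C_def P_def)
    qed
    moreover have "(\<forall>j\<in>{..i}. z \<in> C j) \<longleftrightarrow> (\<forall>j<i. P j z) \<and> \<not> P i z" for z
    proof -
      have "{..i} = insert i {..<i}" by auto
      then show ?thesis by (auto simp: C_def)
    qed
    ultimately show ?thesis by simp
  qed
  have L_ind: "of_bool (z \<in> L) = (of_bool (\<forall>i<K. P i z) :: real)" if "z \<in> words Q n" for z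
    using that by (simp add: L_def P_def)
  have "(\<Sum>z\<in>words Q n. (1 - of_bool (z \<in> L)) * f z) =
      (\<Sum>z\<in>words Q n. \<Sum>i<K. of_bool ((\<forall>j<i. P j z) \<and> \<not> P i z) * f z)"
    unfolding sum_distrib_right[symmetric] sum_first_failure by (simp add: L_ind)
  also have "\<dots> = (\<Sum>i<K. \<Sum>z\<in>words Q n. of_bool ((\<forall>j<i. P j z) \<and> \<not> P i z) * f z)"
    by (rule sum.swap)
  also have "\<dots> \<le> (\<Sum>i<K. \<eta> * real Q ^ n)" using part by (intro sum_mono) auto
  finally have out: "(\<Sum>z\<in>words Q n. (1 - of_bool (z \<in> L)) * f z) \<le> real K * \<eta> * real Q ^ n" by simp
  have XL: "X \<inter> L \<subseteq> words K n"
  proof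
    fix z assume z: "z \<in> X \<inter> L"
    then have zw: "z \<in> words (Suc K) n" using X(1) by (auto simp: Q_def)
    have "K \<notin> set z"
    proof
      assume Kz: "K \<in> set z"
      \<comment> \<open>The letter \<open>K\<close> becomes the wildcard \<open>Suc K\<close> of a
        line over the larger alphabet; its point for the letter \<open>K\<close> is \<open>z\<close>
        itself.\<close>
      let ?z = "sub K (Suc K) z"
      have "?z \<in> words (Suc (Suc K)) n" "Suc K \<in> set ?z"
        using zw Kz by (auto simp: sub_def image_iff intro!: map_in_words)
      moreover have "sub (Suc K) i ?z \<in> X" if "i < Suc K" for i
      proof (cases "i = K")
        case True
        have "sub K K z = z" by (auto simp: sub_def intro: map_idI)
        then show ?thesis using True z sub_sub_Suc[OF zw] by simp
      next
        case False
        then show ?thesis using that z sub_sub_Suc[OF zw] by (simp add: L_def)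
      qed
      ultimately show False using X(2) unfolding contains_line_def Q_def by blast
    qed
    then show "z \<in> words K n" using zw by (simp add: words_def lessThan_Suc subset_insert)
  qed
  have "real (card X) = (\<Sum>z\<in>words Q n. of_bool (z \<in> X))"
    using X(1) unfolding sum_of_bool_words by (simp add: Collect_conj_eq Int_absorb1)
  also have "\<dots> = (\<Sum>z\<in>words Q n. of_bool (z \<in> X \<inter> L)) + (\<Sum>z\<in>words Q n. (1 - of_bool (z \<in> L)) * f z)
      + \<beta> * (\<Sum>z\<in>words Q n. 1 - of_bool (z \<in> L))"
    unfolding sum_distrib_left sum.distrib[symmetric] by (intro sum.cong refl) (auto simp: f_def)
  also have "(\<Sum>z\<in>words Q n. of_bool (z \<in> X \<inter> L)) \<le> real K ^ n"
  proof -
    have "{z \<in> words Q n. z \<in> X \<inter> L} \<subseteq> words K n" using XL by blast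
    then have "card {z \<in> words Q n. z \<in> X \<inter> L} \<le> K ^ n"
      using card_mono[of "words K n"] by auto
    then show ?thesis unfolding sum_of_bool_words by (simp flip: of_nat_power)
  qed
  also have "(\<Sum>z\<in>words Q n. 1 - of_bool (z \<in> L)) = real Q ^ n - real (card L)"
    unfolding sum_subtractf sum_of_bool_words by (simp add: L_def)
  finally show ?thesis using out assms(7) unfolding L_def by (simp add: algebra_simps)
qed

lemma not_contains_line_section:
  assumes "\<not> contains_line K (m + n) D" "w \<in> words K m"
  shows "\<not> contains_line K n {y \<in> words K n. w @ y \<in> D}"
proof
  assume "contains_line K n {y \<in> words K n. w @ y \<in> D}"
  then obtain z where z: "z \<in> words (Suc K) n" "K \<in> set z" "\<And>i. i < K \<Longrightarrow> w @ sub K i z \<in> D"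
    by (auto simp: contains_line_def)
  have "w @ z \<in> words (Suc K) (m + n)"
    using words_mono[of K "Suc K" m] assms(2) z(1) by (auto simp: words_def)
  moreover have "K \<in> set (w @ z)" using z(2) by simp
  moreover have "sub K i (w @ z) \<in> D" if "i < K" for i using z(3)[OF that] sub_id[OF assms(2)] by simp
  ultimately show False using assms(1) unfolding contains_line_def by blast
qed

text \<open>
  Let \<open>\<delta>\<close> be the critical density of line-free sets over \<open>{..<Suc K}\<close>. If \<open>D\<close> is line-free of density
  almost \<open>\<delta>\<close>, then all its sections have density almost \<open>\<delta>\<close>. In a suitable subspace, a fixed
  proportion of the words \<open>z\<close> have \<open>sub K i z\<close> in the section of \<open>D\<close> for all \<open>i < K\<close>. No such \<open>z\<close> containing \<open>K\<close>
  lies in the section, so that it is too dense on the remaining words; these form a disjoint union of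
  intersections of insensitive sets, hence essentially of subspaces on which the density is at most about \<open>\<delta>\<close>.
\<close>

lemma dhj_Suc:
  assumes "dhj K" "1 \<le> K"
  shows "dhj (Suc K)"
proof -
  define Q where "Q = Suc K"
  have Q: "0 < real Q" by (simp add: Q_def)
  \<comment> \<open>The densities that line-free sets of large length cannot exceed. The infimum is
    the critical density, and the claim amounts to \<open>\<delta> \<le> 0\<close>.\<close>
  define S where "S = {d :: real. \<exists>N. \<forall>n\<ge>N. \<forall>D\<subseteq>words Q n. \<not> contains_line Q n D \<longrightarrow> real (card D) \<le> d * real Q ^ n}"
  define \<delta> where "\<delta> = Inf S"
  have S_nonneg: "0 \<le> d" if d: "d \<in> S" for d
  proof -
    obtain N where "\<forall>D\<subseteq>words Q N. \<not> contains_line Q N D \<longrightarrow> real (card D) \<le> d * real Q ^ N"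
      using d unfolding S_def by blast
    moreover have "\<not> contains_line Q N {}" by (auto simp: contains_line_def Q_def)
    ultimately have "0 \<le> d * real Q ^ N" using card.empty by (metis empty_subsetI of_nat_0)
    then show ?thesis using zero_less_power[OF Q, of N] mult_neg_pos[of d "real Q ^ N"] by linarith
  qed
  then have bdd: "bdd_below S" by (rule bdd_belowI)
  have "1 \<in> S"
  proof -
    have "real (card D) \<le> 1 * real Q ^ n" if "D \<subseteq> words Q n" for D n
      using card_mono[OF _ that] by (simp flip: of_nat_power)
    then show ?thesis unfolding S_def by blast
  qed
  have "\<not> 0 < \<delta>"
  proof
    assume "0 < \<delta>"
    then have "0 < \<delta> / 2 / 2" by simp
    then obtain N0 where N0: "\<forall>n\<ge>N0. \<forall>D\<subseteq>words K n. \<delta> / 2 / 2 * real K ^ n \<le> real (card D) \<longrightarrow> contains_line K n D"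
      using assms(1) unfolding dhj_def by blast
    define m where "m = Suc N0"
    have m: "\<And>D. D \<subseteq> words K m \<Longrightarrow> \<delta> / 2 / 2 * real K ^ m \<le> real (card D) \<Longrightarrow> contains_line K m D" "1 \<le> m"
      using N0 by (auto simp: m_def)
    define \<gamma> where "\<gamma> = \<delta> / 2 / (4 * real Q ^ Suc m)"
    have "0 < \<gamma>" using \<open>0 < \<delta>\<close> Q by (simp add: \<gamma>_def)
    \<comment> \<open>In the end \<open>K + 3\<close> copies of \<open>\<eta>\<close> compete with
      the gain \<open>\<delta> * \<gamma>\<close>: \<open>1 + K\<close> from
      \<open>line_free_card_bound\<close>, one from taking \<open>\<delta> + \<eta>\<close> for
      \<open>\<beta>\<close> there, and one from the lower bound for the sections. The bound
      \<open>\<delta> / 2\<close> keeps these sections dense enough for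
      \<open>lines_in_template\<close>.\<close>
    define \<eta> where "\<eta> = min (\<delta> / 2) (\<delta> * \<gamma> / (real K + 4))"
    have \<eta>: "0 < \<eta>" "\<eta> \<le> \<delta> / 2" "(real K + 4) * \<eta> \<le> \<delta> * \<gamma>"
    proof -
      show "0 < \<eta>" using \<open>0 < \<delta>\<close> \<open>0 < \<gamma>\<close> by (simp add: \<eta>_def)
      show "\<eta> \<le> \<delta> / 2" unfolding \<eta>_def by (rule min.cobounded1)
      have "(real K + 4) * \<eta> \<le> (real K + 4) * (\<delta> * \<gamma> / (real K + 4))"
        unfolding \<eta>_def by (intro mult_left_mono min.cobounded2) simp
      then show "(real K + 4) * \<eta> \<le> \<delta> * \<gamma>" by simp
    qed
    have near: "\<exists>N. \<forall>n\<ge>N. \<forall>D\<subseteq>words Q n. \<not> contains_line Q n D \<longrightarrow> real (card D) \<le> (\<delta> + e) * real Q ^ n"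
      if "0 < e" for e
    proof -
      have "Inf S < \<delta> + e" using that by (simp add: \<delta>_def)
      then obtain d where d: "d \<in> S" "d < \<delta> + e"
        using cInf_lessD[of S "\<delta> + e"] \<open>1 \<in> S\<close> by auto
      have le: "d * real Q ^ n \<le> (\<delta> + e) * real Q ^ n" for n
        using d(2) by (intro mult_right_mono) auto
      obtain N where "\<forall>n\<ge>N. \<forall>D\<subseteq>words Q n. \<not> contains_line Q n D \<longrightarrow> real (card D) \<le> d * real Q ^ n"
        using d(1) unfolding S_def by blast
      then show ?thesis using order_trans[OF _ le] by blast
    qed
    obtain l where l: "\<forall>D\<subseteq>words Q l. \<not> contains_line Q l D \<longrightarrow> real (card D) \<le> (\<delta> + \<eta>) * real Q ^ l"
      using near[OF \<eta>(1)] by blast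
    have "\<forall>i\<in>{..<K}. \<exists>N. \<forall>n\<ge>N. insensitive_sums_bounded K {..i} l n \<eta>"
      using assms \<eta>(1) by (intro ballI insensitive_sums_bounded) auto
    from bchoice[OF this] obtain NM where NM: "\<forall>i\<in>{..<K}. \<forall>n\<ge>NM i. insensitive_sums_bounded K {..i} l n \<eta>"
      by blast
    have "(\<lambda>n. (real K / real Q) ^ n) \<longlonglongrightarrow> 0"
      by (rule LIMSEQ_power_zero) (simp add: Q_def)
    then have "\<forall>\<^sub>F n in sequentially. (real K / real Q) ^ n < \<eta>"
      using \<eta>(1) by (rule order_tendstoD(2))
    then obtain N' where N': "\<And>n. n \<ge> N' \<Longrightarrow> (real K / real Q) ^ n < \<eta>"
      by (auto simp: eventually_sequentially)
    define M where "M = N' + Max (NM ` {..<K})"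
    have isb: "insensitive_sums_bounded K {..i} l (Suc M) \<eta>" if "i < K" for i
    proof -
      have "NM i \<le> Max (NM ` {..<K})" using that by simp
      then have "NM i \<le> Suc M" by (simp add: M_def)
      then show ?thesis using NM that by blast
    qed
    have "real K ^ Suc M / real Q ^ Suc M < \<eta>"
      using N'[of "Suc M"] unfolding power_divide by (simp add: M_def)
    then have KM: "real K ^ Suc M \<le> \<eta> * real Q ^ Suc M"
      using Q by (simp add: pos_divide_less_eq del: power_Suc)
    define G where "G n \<longleftrightarrow> (\<forall>(Y :: nat list set) E. finite Y \<longrightarrow> Y \<noteq> {} \<longrightarrow>
      (\<forall>w\<in>words K (m + n). \<delta> / 2 * real (card Y) \<le> real (card {y \<in> Y. w \<in> E y})) \<longrightarrow>
      (\<exists>v\<in>templates K (Suc M) (m + n). \<gamma> * real (card Y) * real Q ^ Suc M \<le>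
        (\<Sum>z\<in>words Q (Suc M). real (card {y \<in> Y. \<forall>i<K. fill v (sub K i z) \<in> E y}))))" for n
    have "\<exists>n. G n"
      unfolding G_def \<gamma>_def Q_def
      by (rule lines_in_template[OF m(1) assms(2) m(2) half_gt_zero[OF \<open>0 < \<delta>\<close>]])
    then obtain n0 where "G n0" by blast
    note n0 = this[unfolded G_def, rule_format]
    define p where "p = m + n0"
    \<comment> \<open>Chosen after the prefix length \<open>p\<close>: one section may have to make
      up for the excess of all others, so the error is multiplied by up to
      \<open>2 * Q ^ p\<close>.\<close>
    define e where "e = \<eta> / real Q ^ p / 2"
    have "0 < e" using \<eta>(1) Q by (simp add: e_def)
    obtain l' where l': "\<And>n D. n \<ge> l' \<Longrightarrow> D \<subseteq> words Q n \<Longrightarrow> \<not> contains_line Q n D \<Longrightarrow> real (card D) \<le> (\<delta> + e) * real Q ^ n"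
      using near[OF \<open>0 < e\<close>] by blast
    have "\<delta> - e \<notin> S"
      using cInf_lower[OF _ bdd, of "\<delta> - e"] \<open>0 < e\<close> by (auto simp: \<delta>_def)
    then obtain n' D where n'D: "p + l' \<le> n'" "D \<subseteq> words Q n'" "\<not> contains_line Q n' D" "\<not> real (card D) \<le> (\<delta> - e) * real Q ^ n'"
      unfolding S_def by blast
    define n where "n = n' - p"
    have D: "l' \<le> n" "D \<subseteq> words Q (p + n)" "\<not> contains_line Q (p + n) D" "(\<delta> - e) * real Q ^ (p + n) < real (card D)"
      using n'D by (auto simp: n_def)
    have sec_card: "(\<delta> - \<eta>) * real Q ^ n \<le> real (card {y \<in> words Q n. w @ y \<in> D})" if w: "w \<in> words Q p" for w
    proof -
      let ?c = "\<lambda>w. real (card {y \<in> words Q n. w @ y \<in> D})"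
      have c_le: "?c u \<le> (\<delta> + e) * real Q ^ n" if "u \<in> words Q p" for u
        using not_contains_line_section[OF D(3) that] D(1) by (intro l') auto
      have "real (card D) = (\<Sum>x\<in>words Q (p + n). of_bool (x \<in> D))"
        using D(2) unfolding sum_of_bool_words by (simp add: Collect_conj_eq Int_absorb1)
      also have "\<dots> = (\<Sum>u\<in>words Q p. ?c u)" unfolding sum_words_append unfolding sum_of_bool_words ..
      also have "\<dots> = ?c w + (\<Sum>u\<in>words Q p - {w}. ?c u)" using w by (simp add: sum.remove)
      also have "(\<Sum>u\<in>words Q p - {w}. ?c u) \<le> (\<Sum>u\<in>words Q p - {w}. (\<delta> + e) * real Q ^ n)"
        using c_le by (intro sum_mono) auto
      also have "\<dots> = (real Q ^ p - 1) * ((\<delta> + e) * real Q ^ n)"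
        using w by (simp add: of_nat_diff Q_def)
      finally have "(\<delta> - e) * real Q ^ p * real Q ^ n \<le> ?c w + (real Q ^ p - 1) * ((\<delta> + e) * real Q ^ n)"
        using D(4) by (simp add: power_add mult_ac)
      then have "(\<delta> + e - 2 * e * real Q ^ p) * real Q ^ n \<le> ?c w" by (simp add: algebra_simps)
      moreover have "2 * e * real Q ^ p = \<eta>" using Q by (simp add: e_def)
      moreover have "(\<delta> - \<eta>) * real Q ^ n \<le> (\<delta> + e - \<eta>) * real Q ^ n"
        using \<open>0 < e\<close> by (intro mult_right_mono) auto
      ultimately show ?thesis by simp
    qed
    let ?Y = "words Q n"
    have "?Y \<noteq> {}" using card_words[of Q n] by (auto simp: Q_def simp del: card_words)
    have E_dense: "\<delta> / 2 * real (card ?Y) \<le> real (card {y \<in> ?Y. w \<in> {u. u @ y \<in> D}})" if "w \<in> words K (m + n0)" for w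
    proof -
      have "\<delta> / 2 * real Q ^ n \<le> (\<delta> - \<eta>) * real Q ^ n"
        using \<eta>(2) by (intro mult_right_mono) auto
      also have "\<dots> \<le> real (card {y \<in> ?Y. w @ y \<in> D})"
        using that words_mono[of K Q] by (intro sec_card) (auto simp: p_def Q_def)
      finally show ?thesis by simp
    qed
    obtain v where v: "v \<in> templates K (Suc M) p" "\<gamma> * real (card ?Y) * real Q ^ Suc M \<le>
        (\<Sum>z\<in>words Q (Suc M). real (card {y \<in> ?Y. \<forall>i<K. fill v (sub K i z) \<in> {u. u @ y \<in> D}}))"
      using n0[of ?Y "\<lambda>y. {u. u @ y \<in> D}", OF finite_words \<open>?Y \<noteq> {}\<close> E_dense] unfolding p_def by blast
    have vQ: "v \<in> templates Q (Suc M) p" using v(1) templates_mono[of K Q] by (auto simp: Q_def)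
    define X where "X y = {w \<in> words Q (Suc M). fill v w @ y \<in> D}" for y
    define L where "L y = {z \<in> words Q (Suc M). \<forall>i<K. sub K i z \<in> X y}" for y
    \<comment> \<open>Holds for each \<open>y\<close> separately, but the contradiction comes from
      the sum over \<open>y\<close>: the sizes of \<open>L y\<close> and \<open>X y\<close> are
      bounded below only on average.\<close>
    have X_bound: "real (card (X y)) \<le> (1 + real K) * \<eta> * real Q ^ Suc M +
        (\<delta> + \<eta>) * (real Q ^ Suc M - real (card (L y)))" if y: "y \<in> ?Y" for y
      unfolding L_def Q_def
    proof (rule line_free_card_bound[where m = l])
      have vy: "v @ map Inl y \<in> templates Q (Suc M) (p + n)"
        using vQ y by (rule append_map_Inl_templates)
      show X_free: "\<not> contains_line (Suc K) (Suc M) (X y)"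
        using contains_line_vimage[OF vy, of D] D(3) unfolding X_def by (auto simp: fill_append Q_def)
      show "real (card {w \<in> words (Suc K) l. fill u w \<in> X y}) \<le> (\<delta> + \<eta>) * real (Suc K) ^ l"
        if u: "u \<in> templates (Suc K) l (Suc M)" for u
        using l[unfolded Q_def, rule_format, of "{w \<in> words (Suc K) l. fill u w \<in> X y}"]
          contains_line_vimage[OF u, of "X y"] X_free by blast
    qed (use isb KM \<open>0 < \<delta>\<close> \<eta>(1) in \<open>auto simp: X_def Q_def\<close>)
    let ?T = "real Q ^ Suc M * real Q ^ n"
    have "(\<Sum>y\<in>?Y. real (card (X y))) = (\<Sum>w\<in>words Q (Suc M). \<Sum>y\<in>?Y. of_bool (fill v w @ y \<in> D))"
      unfolding X_def sum_of_bool_words[symmetric] by (rule sum.swap)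
    also have "\<dots> \<ge> (\<Sum>w\<in>words Q (Suc M). (\<delta> - \<eta>) * real Q ^ n)"
      unfolding sum_of_bool_words using fill_in_words[OF vQ] by (intro sum_mono sec_card) auto
    finally have sumX: "(\<delta> - \<eta>) * ?T \<le> (\<Sum>y\<in>?Y. real (card (X y)))"
      by (simp add: mult_ac)
    have sub_w: "sub K i z \<in> words Q (Suc M)" if "z \<in> words Q (Suc M)" "i < K" for i z
      using sub_in_words[of z K "Suc M" i] that words_mono[of K Q] by (auto simp: Q_def)
    have "(\<Sum>z\<in>words Q (Suc M). real (card {y \<in> ?Y. \<forall>i<K. fill v (sub K i z) @ y \<in> D}))
        = (\<Sum>z\<in>words Q (Suc M). real (card {y \<in> ?Y. \<forall>i<K. sub K i z \<in> X y}))"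
      using sub_w by (intro sum.cong refl arg_cong[where f = "\<lambda>A. real (card A)"]) (auto simp: X_def)
    also have "\<dots> = (\<Sum>y\<in>?Y. \<Sum>z\<in>words Q (Suc M). of_bool (\<forall>i<K. sub K i z \<in> X y))"
      unfolding sum_of_bool_words[symmetric] by (rule sum.swap)
    also have "\<dots> = (\<Sum>y\<in>?Y. real (card (L y)))" unfolding sum_of_bool_words L_def ..
    finally have sumL: "\<gamma> * ?T \<le> (\<Sum>y\<in>?Y. real (card (L y)))"
      using v(2) by (simp add: mult_ac)
    have "(\<Sum>y\<in>?Y. real (card (X y))) \<le> (\<Sum>y\<in>?Y. (1 + real K) * \<eta> * real Q ^ Suc M +
        (\<delta> + \<eta>) * (real Q ^ Suc M - real (card (L y))))"
      by (intro sum_mono X_bound)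
    also have "\<dots> = (1 + real K) * \<eta> * ?T + (\<delta> + \<eta>) * (?T - (\<Sum>y\<in>?Y. real (card (L y))))"
      by (simp add: sum.distrib sum_subtractf sum_distrib_left[symmetric] algebra_simps)
    also have "\<dots> \<le> (1 + real K) * \<eta> * ?T + (\<delta> + \<eta>) * (?T - \<gamma> * ?T)"
      using sumL \<open>0 < \<delta>\<close> \<eta>(1) by (intro add_left_mono mult_left_mono) auto
    finally have "(\<delta> - \<eta>) * ?T \<le> ((1 + real K) * \<eta> + (\<delta> + \<eta>) * (1 - \<gamma>)) * ?T"
      using sumX by (simp add: algebra_simps)
    then have "\<delta> - \<eta> \<le> (1 + real K) * \<eta> + (\<delta> + \<eta>) * (1 - \<gamma>)"
      using Q by (simp add: mult_le_cancel_right del: power_Suc)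
    then have "\<delta> * \<gamma> + \<eta> * \<gamma> \<le> (real K + 3) * \<eta>" by (simp add: algebra_simps)
    moreover have "0 < \<eta> * \<gamma>" using \<eta>(1) \<open>0 < \<gamma>\<close> by simp
    moreover have "(real K + 3) * \<eta> < (real K + 4) * \<eta>" using \<eta>(1) by simp
    ultimately show False using \<eta>(3) by linarith
  qed
  show ?thesis
    unfolding dhj_def Q_def[symmetric]
  proof (intro allI impI)
    fix e :: real assume "0 < e"
    then have "Inf S < e" using \<open>\<not> 0 < \<delta>\<close> by (simp add: \<delta>_def)
    then obtain d where d: "d \<in> S" "d < e" using cInf_lessD[of S e] \<open>1 \<in> S\<close> by auto
    then obtain N where N: "\<And>n D. n \<ge> N \<Longrightarrow> D \<subseteq> words Q n \<Longrightarrow> \<not> contains_line Q n D \<Longrightarrow> real (card D) \<le> d * real Q ^ n"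
      unfolding S_def by blast
    have "contains_line Q n D" if "n \<ge> N" "D \<subseteq> words Q n" "e * real Q ^ n \<le> real (card D)" for n D
    proof (rule ccontr)
      assume "\<not> contains_line Q n D"
      then have "e * real Q ^ n \<le> d * real Q ^ n" using N[OF that(1,2)] that(3) by linarith
      then show False using d(2) Q by simp
    qed
    then show "\<exists>N. \<forall>n\<ge>N. \<forall>D\<subseteq>words Q n. e * real Q ^ n \<le> real (card D) \<longrightarrow> contains_line Q n D" by blast
  qed
qed

theorem density_Hales_Jewett: "1 \<le> K \<Longrightarrow> dhj K"
proof (induction K rule: dec_induct)
  case base
  have "contains_line 1 n D" if "1 \<le> n" "D \<subseteq> words 1 n" "\<delta> * real 1 ^ n \<le> real (card D)" "0 < \<delta>" for n D and \<delta> :: real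
  proof -
    have "0 < card D" using that(3,4) by simp
    then obtain d where "d \<in> D" by fastforce
    moreover have "w = replicate n 0" if "w \<in> words 1 n" for w
      using that by (intro nth_equalityI) (auto simp: length_words dest: nth_words)
    ultimately have "replicate n 0 \<in> D" using that(2) by fastforce
    then have "replicate n 1 \<in> words (Suc 1) n" "1 \<in> set (replicate n (1 :: nat))" "\<forall>i<1. sub 1 i (replicate n 1) \<in> D"
      using that(1) by (auto simp: words_def sub_def)
    then show ?thesis unfolding contains_line_def by blast
  qed
  then show ?case unfolding dhj_def by blast
next
  case (step K)
  then show ?case using dhj_Suc by simp
qed

section \<open>Grids in dense subsets of the plane\<close>

text \<open>Along a line the weight is affine in \<open>f i\<close>, with the number of wildcards as
  slope; this number becomes the gap \<open>q\<close>.\<close>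

lemma sum_list_map_sub:
  "sum_list (map f (sub K i z)) = sum_list (map f (filter ((\<noteq>) K) z)) + count_list z K * (f i :: nat)"
  by (induction z) (auto simp: sub_def)

lemma sum_list_map_words_le:
  fixes f :: "nat \<Rightarrow> nat"
  assumes "w \<in> words K n" "\<And>a. a < K \<Longrightarrow> f a \<le> r"
  shows "sum_list (map f w) \<le> r * n"
proof -
  have "f a \<le> r" if "a \<in> set w" for a using assms that by (auto simp: words_def subset_iff)
  then have "sum_list (map f w) \<le> sum_list (map (\<lambda>_. r) w)" by (intro sum_list_mono) auto
  then show ?thesis using assms(1) by (simp add: words_def sum_list_triv mult.commute)
qed

text \<open>Only points of \<open>B\<close> in the two edge strips of width \<open>h\<close> can be
  missed, at most \<open>2 * h * N\<close> of them.\<close>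

lemma card_translate_box:
  assumes "B \<subseteq> {..<N} \<times> {..<N}" "s \<le> h" "t \<le> (h :: nat)"
  shows "card B \<le> card {x \<in> {..<N} \<times> {..<N}. (fst x + s, snd x + t) \<in> B} + 2 * h * N"
proof -
  let ?X = "{x \<in> {..<N} \<times> {..<N}. (fst x + s, snd x + t) \<in> B}"
  have "B \<subseteq> (\<lambda>x. (fst x + s, snd x + t)) ` ?X \<union> ({..<h} \<times> {..<N} \<union> {..<N} \<times> {..<h})"
  proof
    fix b assume b: "b \<in> B"
    then have bN: "fst b < N" "snd b < N" using assms(1) by auto
    show "b \<in> (\<lambda>x. (fst x + s, snd x + t)) ` ?X \<union> ({..<h} \<times> {..<N} \<union> {..<N} \<times> {..<h})"
    proof (cases "s \<le> fst b \<and> t \<le> snd b")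
      case True
      then have "(fst b - s, snd b - t) \<in> ?X" using b bN by (simp add: less_imp_diff_less)
      then have "b \<in> (\<lambda>x. (fst x + s, snd x + t)) ` ?X"
        by (rule rev_image_eqI) (use True in auto)
      then show ?thesis by blast
    next
      case False
      then show ?thesis using bN assms(2,3) by (cases b) auto
    qed
  qed
  then have "card B \<le> card ((\<lambda>x. (fst x + s, snd x + t)) ` ?X \<union> ({..<h} \<times> {..<N} \<union> {..<N} \<times> {..<h}))"
    by (intro card_mono) auto
  also have "\<dots> \<le> card ((\<lambda>x. (fst x + s, snd x + t)) ` ?X) + (card ({..<h} \<times> {..<N}) + card ({..<N} \<times> {..<h}))"
    by (meson add_left_mono card_Un_le order_trans)
  also have "card ((\<lambda>x. (fst x + s, snd x + t)) ` ?X) \<le> card ?X"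
    by (intro card_image_le) auto
  finally show ?thesis by (simp add: card_cartesian_product mult_ac)
qed

text \<open>Letters encode the points of \<open>{0..r} \<times> {0..r}\<close>, and a word the sum
  of its letters. Averaging over base points \<open>x\<close> gives one for which the words landing
  in \<open>B\<close> are dense; a line among them is a homothetic copy of the grid of letters, with
  the same gap in both directions.\<close>

theorem grid_in_dense_set:
  fixes \<epsilon> :: real
  assumes "0 < \<epsilon>"
  shows "\<exists>N0. \<forall>N\<ge>N0. \<forall>B\<subseteq>{..<N} \<times> {..<N}. \<epsilon> * (real N)\<^sup>2 \<le> real (card B) \<longrightarrow>
    (\<exists>q>0. \<exists>c1 c2. \<forall>i\<le>r. \<forall>j\<le>r. (c1 + q * i, c2 + q * j) \<in> B)"
proof -
  define K where "K = Suc r * Suc r"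
  define f g where "f a = a div Suc r" and "g a = a mod Suc r" for a
  have fg: "f a \<le> r" "g a \<le> r" if "a < K" for a
    using that unfolding K_def f_def g_def by (simp_all add: less_mult_imp_div_less flip: less_Suc_eq_le)
  have "0 < \<epsilon> / 2" using assms by simp
  moreover have "dhj K" by (rule density_Hales_Jewett) (simp add: K_def)
  ultimately obtain n where n: "\<And>D. D \<subseteq> words K n \<Longrightarrow> \<epsilon> / 2 * real K ^ n \<le> real (card D) \<Longrightarrow> contains_line K n D"
    unfolding dhj_def by (meson order_refl)
  define h where "h = r * n"
  \<comment> \<open>Makes the edge strips lost in a translation by at most \<open>h\<close> cost no
    more than half of \<open>\<epsilon>\<close>.\<close>
  obtain N0 where N0: "4 * real h / \<epsilon> < real N0" using reals_Archimedean2 by blast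
  have "\<exists>q>0. \<exists>c1 c2. \<forall>i\<le>r. \<forall>j\<le>r. (c1 + q * i, c2 + q * j) \<in> B"
    if N: "N \<ge> Suc N0" and B: "B \<subseteq> {..<N} \<times> {..<N}" "\<epsilon> * (real N)\<^sup>2 \<le> real (card B)" for N B
  proof -
    let ?box = "{..<N} \<times> {..<N}"
    define s t where "s w = sum_list (map f w)" and "t w = sum_list (map g w)" for w
    define W where "W x = {w \<in> words K n. (fst x + s w, snd x + t w) \<in> B}" for x
    have "4 * real h / \<epsilon> \<le> real N" using N0 N by linarith
    then have "real h * 4 \<le> \<epsilon> * real N" using assms by (simp add: field_simps)
    from mult_right_mono[OF this, of "real N"]
    have "2 * real h * real N \<le> \<epsilon> / 2 * (real N)\<^sup>2" by (simp add: power2_eq_square mult_ac)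
    then have sec: "\<epsilon> / 2 * (real N)\<^sup>2 \<le> real (card {x \<in> ?box. (fst x + s w, snd x + t w) \<in> B})"
      if "w \<in> words K n" for w
    proof -
      have "s w \<le> h" "t w \<le> h"
        using sum_list_map_words_le[OF that] fg by (auto simp: s_def t_def h_def)
      from card_translate_box[OF B(1) this]
      have "real (card B) \<le> real (card {x \<in> ?box. (fst x + s w, snd x + t w) \<in> B} + 2 * h * N)"
        unfolding of_nat_le_iff .
      then show ?thesis
        using B(2) \<open>2 * real h * real N \<le> \<epsilon> / 2 * (real N)\<^sup>2\<close> by simp
    qed
    have "\<exists>x\<in>?box. \<epsilon> / 2 * real K ^ n \<le> real (card (W x))"
    proof (rule ccontr)
      assume no: "\<not> ?thesis"
      have "(\<Sum>w\<in>words K n. \<epsilon> / 2 * (real N)\<^sup>2) \<le> (\<Sum>w\<in>words K n. \<Sum>x\<in>?box. of_bool ((fst x + s w, snd x + t w) \<in> B))"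
      proof (intro sum_mono)
        fix w assume "w \<in> words K n"
        have "(\<Sum>x\<in>?box. of_bool ((fst x + s w, snd x + t w) \<in> B)) = real (card {x \<in> ?box. (fst x + s w, snd x + t w) \<in> B})"
          by (simp add: Int_def)
        then show "\<epsilon> / 2 * (real N)\<^sup>2 \<le> (\<Sum>x\<in>?box. of_bool ((fst x + s w, snd x + t w) \<in> B))"
          using sec[OF \<open>w \<in> words K n\<close>] by linarith
      qed
      also have "\<dots> = (\<Sum>x\<in>?box. \<Sum>w\<in>words K n. of_bool ((fst x + s w, snd x + t w) \<in> B))"
        by (rule sum.swap)
      also have "\<dots> = (\<Sum>x\<in>?box. real (card (W x)))"
        unfolding sum_of_bool_words W_def ..
      also have "\<dots> < real (card ?box) * (\<epsilon> / 2 * real K ^ n)"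
        using no N by (intro sum_bounded_above_strict) (auto simp: not_le card_cartesian_product)
      also have "\<dots> = (\<Sum>w\<in>words K n. \<epsilon> / 2 * (real N)\<^sup>2)"
        by (simp add: card_cartesian_product power2_eq_square)
      finally show False by simp
    qed
    then obtain x where "\<epsilon> / 2 * real K ^ n \<le> real (card (W x))" by blast
    then have "contains_line K n (W x)" by (intro n) (auto simp: W_def)
    then obtain z where z: "z \<in> words (Suc K) n" "K \<in> set z" "\<And>a. a < K \<Longrightarrow> sub K a z \<in> W x"
      unfolding contains_line_def by blast
    define c d q where "c = fst x + sum_list (map f (filter ((\<noteq>) K) z))"
      and "d = snd x + sum_list (map g (filter ((\<noteq>) K) z))" and "q = count_list z K"
    have "(c + q * i, d + q * j) \<in> B" if "i \<le> r" "j \<le> r" for i j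
    proof -
      define a where "a = i * Suc r + j"
      have "i * Suc r \<le> r * Suc r" using that(1) by (rule mult_le_mono1)
      then have "a < K" using that(2) unfolding a_def K_def mult_Suc by linarith
      moreover have "f a = i" "g a = j"
        using that unfolding f_def g_def a_def by (simp_all del: mult_Suc_right)
      ultimately show ?thesis
        using z(3)[of a] by (simp add: W_def s_def t_def sum_list_map_sub c_def d_def q_def add.assoc)
    qed
    moreover have "0 < q" using z(2) by (simp add: q_def count_list_0_iff neq0_conv[symmetric] del: neq0_conv)
    ultimately show ?thesis by blast
  qed
  then show ?thesis by blast
qed

section \<open>Replete sets of levels\<close>

text \<open>
  The replete sets of levels for the nodes of \<open>A\<close> at or below \<open>w\<close>, among the \<open>d\<close> levels starting with that of \<open>w\<close>.
\<close>

fun replete :: "'a set \<Rightarrow> 'a list set \<Rightarrow> nat \<Rightarrow> 'a list \<Rightarrow> nat set set" where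
  "replete \<Lambda> A 0 w = {{}}"
| "replete \<Lambda> A (Suc d) w = (\<Union>l\<in>\<Lambda>. replete \<Lambda> A d (w @ [l])) \<union>
     (if w \<in> A then insert (length w) ` (\<Inter>l\<in>\<Lambda>. replete \<Lambda> A d (w @ [l])) else {})"

lemma replete_subset:
  assumes "\<Lambda> \<noteq> {}" "H \<in> replete \<Lambda> A d w"
  shows "H \<subseteq> {length w..<length w + d}"
  using assms(2)
proof (induction d arbitrary: w H)
  case (Suc d)
  obtain H' l where H': "H \<subseteq> insert (length w) H'" "l \<in> \<Lambda>" "H' \<in> replete \<Lambda> A d (w @ [l])"
    using Suc.prems assms(1) by (fastforce split: if_splits)
  then have "H' \<subseteq> {Suc (length w)..<Suc (length w) + d}" using Suc.IH[OF H'(3)] by simp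
  then show ?case using H'(1) by force
qed simp

lemma finite_replete:
  assumes "\<Lambda> \<noteq> {}"
  shows "finite (replete \<Lambda> A d w)"
proof (rule finite_subset)
  show "replete \<Lambda> A d w \<subseteq> Pow {length w..<length w + d}"
    using replete_subset[OF assms] by blast
qed simp

lemma empty_in_replete: "\<Lambda> \<noteq> {} \<Longrightarrow> {} \<in> replete \<Lambda> A d w"
  by (induction d arbitrary: w) auto

lemma card_replete_pos: "\<Lambda> \<noteq> {} \<Longrightarrow> 0 < card (replete \<Lambda> A d w)"
  using finite_replete[of \<Lambda> A d w] empty_in_replete[of \<Lambda> A d w] by (auto simp: card_gt_0_iff)

text \<open>With union \<open>U\<close>, intersection \<open>I\<close> and
  \<open>k = card \<Lambda>\<close>, a member outside \<open>I\<close> lies in at most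
  \<open>k - 1\<close> of the families, so the sizes sum to at most
  \<open>(k - 1) * card U + card I\<close>, and also to at most \<open>k * card U\<close>. Adding
  \<open>k\<close> times the first bound to the second gives the factor
  \<open>1 + 1 / k\<close>.\<close>

lemma card_Union_add_card_Inter:
  assumes "finite \<Lambda>" "\<Lambda> \<noteq> {}" "\<And>l. l \<in> \<Lambda> \<Longrightarrow> finite (F l)"
  shows "(1 + 1 / real (card \<Lambda>)) * ((\<Sum>l\<in>\<Lambda>. real (card (F l))) / real (card \<Lambda>)) \<le>
    real (card (\<Union>l\<in>\<Lambda>. F l)) + real (card (\<Inter>l\<in>\<Lambda>. F l))"
proof -
  define k where "k = real (card \<Lambda>)"
  define U I where "U = (\<Union>l\<in>\<Lambda>. F l)" and "I = (\<Inter>l\<in>\<Lambda>. F l)"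
  let ?S = "\<Sum>l\<in>\<Lambda>. real (card (F l))"
  have k: "1 \<le> k" using assms by (simp add: k_def Suc_le_eq card_gt_0_iff)
  have fin: "finite U" unfolding U_def using assms by blast
  have IU: "I \<subseteq> U" unfolding U_def I_def using assms(2) by auto
  have "?S = (\<Sum>l\<in>\<Lambda>. \<Sum>x\<in>U. of_bool (x \<in> F l))"
  proof (intro sum.cong refl)
    fix l assume l: "l \<in> \<Lambda>"
    then have "U \<inter> F l = F l" unfolding U_def by blast
    then show "real (card (F l)) = (\<Sum>x\<in>U. of_bool (x \<in> F l))" using fin by simp
  qed
  also have "\<dots> = (\<Sum>x\<in>U. \<Sum>l\<in>\<Lambda>. of_bool (x \<in> F l))" by (rule sum.swap)
  also have "\<dots> \<le> (\<Sum>x\<in>U. (k - 1) + of_bool (x \<in> I))"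
  proof (intro sum_mono)
    fix x
    have *: "(\<Sum>l\<in>\<Lambda>. of_bool (x \<in> F l)) = real (card {l \<in> \<Lambda>. x \<in> F l})"
      using assms(1) by (simp add: Int_def)
    show "(\<Sum>l\<in>\<Lambda>. of_bool (x \<in> F l)) \<le> (k - 1) + of_bool (x \<in> I)"
    proof (cases "x \<in> I")
      case True
      then show ?thesis unfolding * k_def using assms(1) by (simp add: card_mono)
    next
      case False
      then have "{l \<in> \<Lambda>. x \<in> F l} \<subset> \<Lambda>" unfolding I_def by blast
      then have "card {l \<in> \<Lambda>. x \<in> F l} < card \<Lambda>" by (rule psubset_card_mono[OF assms(1)])
      then show ?thesis unfolding * k_def using False by simp
    qed
  qed
  also have "\<dots> = (k - 1) * real (card U) + real (card I)"
    using fin IU by (simp add: sum.distrib mult.commute Int_absorb1)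
  finally have 1: "?S \<le> (k - 1) * real (card U) + real (card I)" .
  have "?S \<le> (\<Sum>l\<in>\<Lambda>. real (card U))"
    using fin by (intro sum_mono) (auto simp: U_def intro!: card_mono)
  then have 2: "?S \<le> k * real (card U)" by (simp add: k_def)
  have "(k + 1) * ?S \<le> k * ?S + k * real (card U)" using 2 by (simp add: algebra_simps)
  also have "k * ?S \<le> k * ((k - 1) * real (card U) + real (card I))"
    using 1 k by (intro mult_left_mono) auto
  also have "k * ((k - 1) * real (card U) + real (card I)) + k * real (card U)
      = k * k * real (card U) + 1 * (k * real (card I))" by (simp add: algebra_simps)
  also have "\<dots> \<le> k * k * real (card U) + k * (k * real (card I))"
    using k by (intro add_left_mono mult_right_mono) auto
  finally have "(k + 1) * ?S \<le> (k * k) * (real (card U) + real (card I))"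
    by (simp add: algebra_simps)
  then have "(k + 1) * ?S / (k * k) \<le> real (card U) + real (card I)"
    using k by (simp add: pos_divide_le_eq mult.commute)
  moreover have "(1 + 1 / k) * (?S / k) = (k + 1) * ?S / (k * k)"
    using k by (simp add: field_simps)
  ultimately show ?thesis unfolding k_def U_def I_def by simp
qed

text \<open>Sets from a branching at \<open>w\<close> contain the level \<open>length w\<close>,
  those inherited from the children only later levels; so the two kinds are disjoint and
  \<open>insert\<close> is injective.\<close>

lemma card_replete_Suc:
  assumes "\<Lambda> \<noteq> {}" "w \<in> A"
  shows "card (replete \<Lambda> A (Suc d) w) =
    card (\<Union>l\<in>\<Lambda>. replete \<Lambda> A d (w @ [l])) + card (\<Inter>l\<in>\<Lambda>. replete \<Lambda> A d (w @ [l]))"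
proof -
  let ?U = "\<Union>l\<in>\<Lambda>. replete \<Lambda> A d (w @ [l])" and ?I = "\<Inter>l\<in>\<Lambda>. replete \<Lambda> A d (w @ [l])"
  have notin: "length w \<notin> H" if "H \<in> ?U" for H
    using that replete_subset[OF assms(1)] by fastforce
  have "?I \<subseteq> ?U" using assms(1) by auto
  then have "inj_on (insert (length w)) ?I"
  proof (intro inj_onI)
    fix H H' assume "?I \<subseteq> ?U" "H \<in> ?I" "H' \<in> ?I" and eq: "insert (length w) H = insert (length w) H'"
    then have "length w \<notin> H" "length w \<notin> H'" using notin by blast+
    then show "H = H'" using eq by (simp add: insert_ident)
  qed
  then have "card (insert (length w) ` ?I) = card ?I" by (rule card_image)
  moreover have "card (?U \<union> insert (length w) ` ?I) = card ?U + card (insert (length w) ` ?I)"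
  proof (rule card_Un_disjoint)
    have "replete \<Lambda> A (Suc d) w = ?U \<union> insert (length w) ` ?I" using assms(2) by simp
    then have "finite (?U \<union> insert (length w) ` ?I)" using finite_replete[OF assms(1)] by metis
    then show "finite ?U" "finite (insert (length w) ` ?I)" by simp_all
    show "?U \<inter> insert (length w) ` ?I = {}" using notin by blast
  qed
  ultimately show ?thesis using assms(2) by simp
qed

section \<open>Exponentially many replete sets\<close>

definition word_level :: "'a set \<Rightarrow> nat \<Rightarrow> 'a list set" where
  "word_level \<Lambda> i = {u. set u \<subseteq> \<Lambda> \<and> length u = i}"

lemma finite_word_level: "finite \<Lambda> \<Longrightarrow> finite (word_level \<Lambda> i)"
  by (simp add: word_level_def finite_lists_length_eq)

lemma card_word_level: "finite \<Lambda> \<Longrightarrow> card (word_level \<Lambda> i) = card \<Lambda> ^ i"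
  by (simp add: word_level_def card_lists_length_eq)

lemma card_word_level_Suc:
  assumes "finite \<Lambda>"
  shows "card {u \<in> word_level \<Lambda> (Suc i). P u} = (\<Sum>l\<in>\<Lambda>. card {u \<in> word_level \<Lambda> i. P (l # u)})"
proof -
  have "{u \<in> word_level \<Lambda> (Suc i). P u} = (\<Union>l\<in>\<Lambda>. (#) l ` {u \<in> word_level \<Lambda> i. P (l # u)})"
    by (auto simp: word_level_def length_Suc_conv)
  also have "card \<dots> = (\<Sum>l\<in>\<Lambda>. card ((#) l ` {u \<in> word_level \<Lambda> i. P (l # u)}))"
    using assms by (intro card_UN_disjoint) (auto simp: finite_word_level)
  also have "\<dots> = (\<Sum>l\<in>\<Lambda>. card {u \<in> word_level \<Lambda> i. P (l # u)})"
    by (intro sum.cong refl card_image) auto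
  finally show ?thesis .
qed

text \<open>The density sum at \<open>w\<close> is the indicator of \<open>w \<in> A\<close> plus
  the average over the children. By concavity of \<open>ln\<close> the average of the logarithms is
  at most the logarithm of the average family size, and a node in \<open>A\<close> gains the factor
  \<open>1 + 1 / card \<Lambda>\<close> over that size.\<close>

lemma ln_card_replete:
  assumes "finite \<Lambda>" "\<Lambda> \<noteq> {}"
  shows "ln (1 + 1 / real (card \<Lambda>)) * (\<Sum>i<d. real (card {u \<in> word_level \<Lambda> i. w @ u \<in> A}) / real (card \<Lambda>) ^ i)
    \<le> ln (real (card (replete \<Lambda> A d w)))"
proof (induction d arbitrary: w)
  case 0
  then show ?case by simp
next
  case (Suc d)
  define k where "k = real (card \<Lambda>)"
  have k: "1 \<le> k" using assms by (simp add: k_def Suc_le_eq card_gt_0_iff)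
  define \<rho> where "\<rho> = 1 + 1 / k"
  have \<rho>: "1 < \<rho>" using k by (simp add: \<rho>_def)
  let ?F = "\<lambda>l. replete \<Lambda> A d (w @ [l])"
  let ?avg = "(\<Sum>l\<in>\<Lambda>. real (card (?F l))) / k"
  define a where "a w i = real (card {u \<in> word_level \<Lambda> i. w @ u \<in> A})" for w i
  have a_Suc: "a w (Suc i) = (\<Sum>l\<in>\<Lambda>. a (w @ [l]) i)" for i
    unfolding a_def card_word_level_Suc[OF assms(1)] by simp
  have "{u \<in> word_level \<Lambda> 0. w @ u \<in> A} = (if w \<in> A then {[]} else {})"
    by (auto simp: word_level_def)
  then have a0: "a w 0 = of_bool (w \<in> A)" by (simp add: a_def)
  have card_pos: "0 < real (card (?F l))" for l using card_replete_pos[OF assms(2)] by simp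
  then have "0 < (\<Sum>l\<in>\<Lambda>. real (card (?F l)))" using assms by (intro sum_pos) auto
  then have avg_pos: "0 < ?avg" using k by simp
  have "(\<Sum>i<Suc d. a w i / k ^ i) = of_bool (w \<in> A) + (\<Sum>i<d. (\<Sum>l\<in>\<Lambda>. a (w @ [l]) i) / k ^ Suc i)"
    unfolding sum.lessThan_Suc_shift a_Suc a0 by simp
  also have "(\<Sum>i<d. (\<Sum>l\<in>\<Lambda>. a (w @ [l]) i) / k ^ Suc i) = (\<Sum>l\<in>\<Lambda>. (\<Sum>i<d. a (w @ [l]) i / k ^ i) / k)"
    unfolding sum_divide_distrib by (subst sum.swap) (simp add: field_simps)
  finally have "ln \<rho> * (\<Sum>i<Suc d. a w i / k ^ i) =
      ln \<rho> * of_bool (w \<in> A) + (\<Sum>l\<in>\<Lambda>. (ln \<rho> * (\<Sum>i<d. a (w @ [l]) i / k ^ i)) / k)"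
    by (simp add: distrib_left sum_distrib_left)
  also have "(\<Sum>l\<in>\<Lambda>. (ln \<rho> * (\<Sum>i<d. a (w @ [l]) i / k ^ i)) / k) \<le> (\<Sum>l\<in>\<Lambda>. (1 / k) * ln (real (card (?F l))))"
  proof (intro sum_mono)
    fix l
    show "(ln \<rho> * (\<Sum>i<d. a (w @ [l]) i / k ^ i)) / k \<le> (1 / k) * ln (real (card (?F l)))"
      using divide_right_mono[OF Suc.IH[of "w @ [l]"], of k] k by (simp add: \<rho>_def k_def a_def)
  qed
  also have "\<dots> \<le> ln (\<Sum>l\<in>\<Lambda>. (1 / k) *\<^sub>R real (card (?F l)))"
    using assms card_pos k by (intro concave_on_sum[OF _ _ ln_concave]) (auto simp: k_def)
  also have "(\<Sum>l\<in>\<Lambda>. (1 / k) *\<^sub>R real (card (?F l))) = ?avg"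
    by (simp add: sum_divide_distrib)
  also have "ln \<rho> * of_bool (w \<in> A) + ln ?avg \<le> ln (real (card (replete \<Lambda> A (Suc d) w)))"
  proof (cases "w \<in> A")
    case True
    have "ln \<rho> + ln ?avg = ln (\<rho> * ?avg)" using \<rho> avg_pos by (intro ln_mult_pos[symmetric]) auto
    also have "\<dots> \<le> ln (real (card (replete \<Lambda> A (Suc d) w)))"
    proof -
      have "\<rho> * ?avg \<le> real (card (replete \<Lambda> A (Suc d) w))"
        unfolding card_replete_Suc[OF assms(2) True] \<rho>_def k_def of_nat_add
        by (rule card_Union_add_card_Inter[OF assms finite_replete[OF assms(2)]])
      moreover have "0 < \<rho> * ?avg" using \<rho> by (intro mult_pos_pos avg_pos) simp
      ultimately show ?thesis by (meson ln_le_cancel_iff order_less_le_trans)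
    qed
    finally show ?thesis using True by simp
  next
    case False
    have "?avg \<le> real (card (replete \<Lambda> A (Suc d) w))"
    proof -
      have "real (card (?F l)) \<le> real (card (replete \<Lambda> A (Suc d) w))" if "l \<in> \<Lambda>" for l
        using that finite_replete[OF assms(2), of A "Suc d" w] unfolding of_nat_le_iff by (intro card_mono) auto
      then have "(\<Sum>l\<in>\<Lambda>. real (card (?F l))) \<le> k * real (card (replete \<Lambda> A (Suc d) w))"
        unfolding k_def by (rule sum_bounded_above)
      then show ?thesis using k by (simp add: pos_divide_le_eq mult.commute)
    qed
    then show ?thesis using False avg_pos by simp
  qed
  finally show ?case unfolding a_def \<rho>_def k_def by simp
qed

text \<open>
  A Chernoff bound: weigh each \<open>H\<close> by \<open>x ^ card H\<close> for a small \<open>x\<close>.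
\<close>

lemma large_member_of_large_family:
  fixes b :: real
  assumes "0 < b"
  shows "\<exists>c>0. \<forall>N F. F \<subseteq> Pow {..<N} \<longrightarrow> F \<noteq> {} \<longrightarrow> b * real N \<le> ln (real (card F)) \<longrightarrow>
    (\<exists>H\<in>F. c * real N \<le> real (card H))"
proof -
  define x where "x = min (1/2) (b / 4)"
  have x: "0 < x" "x < 1" "x \<le> b / 4" using assms by (auto simp: x_def)
  \<comment> \<open>Gives \<open>x powr (c * N) = exp (- b * N / 4)\<close>. Together with
    \<open>(1 + x) ^ N \<le> exp (b * N / 4)\<close>, a family without large members would have
    \<open>ln (card F)\<close> at most \<open>b / 2 * N\<close>.\<close>
  define c where "c = b / (4 * - ln x)"
  have lx: "ln x < 0" using x by simp
  then have c: "0 < c" "c * - ln x = b / 4" using assms by (auto simp: c_def field_simps divide_neg_neg)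
  have "\<exists>H\<in>F. c * real N \<le> real (card H)"
    if F: "F \<subseteq> Pow {..<N}" "F \<noteq> {}" "b * real N \<le> ln (real (card F))" for N F
  proof (cases "N = 0")
    case True
    then show ?thesis using F(2) by auto
  next
    case False
    show ?thesis
    proof (rule ccontr)
      assume no: "\<not> ?thesis"
      have finF: "finite F" using F(1) finite_subset by blast
      have "real (card F) * x powr (c * real N) = (\<Sum>H\<in>F. x powr (c * real N))" by simp
      also have "\<dots> \<le> (\<Sum>H\<in>F. x ^ card H)"
      proof (intro sum_mono)
        fix H assume "H \<in> F"
        then have "real (card H) \<le> c * real N" using no by (auto simp: not_le)
        then have "x powr (c * real N) \<le> x powr real (card H)" using x by (intro powr_mono') auto
        then show "x powr (c * real N) \<le> x ^ card H" using x by (simp add: powr_realpow)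
      qed
      also have "\<dots> \<le> (\<Sum>H\<in>Pow {..<N}. x ^ card H)"
        using F(1) x by (intro sum_mono2) auto
      also have "\<dots> = (1 + x) ^ N"
        using prod_add[of "{..<N}" "\<lambda>_. x" "\<lambda>_. 1"] by (simp add: add.commute)
      also have "\<dots> \<le> exp x ^ N"
        using x exp_ge_add_one_self[of x] by (intro power_mono) auto
      finally have "real (card F) * x powr (c * real N) \<le> exp x ^ N" .
      moreover have "0 < card F" using finF F(2) by (simp add: card_gt_0_iff)
      ultimately have "ln (real (card F) * x powr (c * real N)) \<le> ln (exp x ^ N)"
        using x by simp
      then have "ln (real (card F)) + c * real N * ln x \<le> real N * x"
        using \<open>0 < card F\<close> x by (simp add: ln_mult_pos ln_powr ln_realpow)
      moreover have "c * real N * ln x = - (b / 4) * real N"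
        unfolding c(2)[symmetric] by simp
      moreover have "real N * x \<le> real N * (b / 4)" using x by (intro mult_left_mono) auto
      ultimately have "b * real N \<le> b / 2 * real N" using F(3) by (simp add: algebra_simps)
      then show False using assms False by simp
    qed
  qed
  then show ?thesis using c(1) by blast
qed

text \<open>Follow \<open>H\<close> down the tree, passing to a single child until a node of level
  \<open>c\<close> is reached at which \<open>H\<close> branches. There all children share the
  replete set \<open>H'\<close>, so subtrees with one order less and first level
  \<open>c + q\<close> can be hung under each of them. The prefix condition keeps each subtree under
  its own child.\<close>

lemma subtree_of_replete:
  assumes "\<Lambda> \<noteq> {}" "0 < q" "w \<in> lists \<Lambda>" "H \<in> replete \<Lambda> A d w" "\<And>i. i \<le> r \<Longrightarrow> c + q * i \<in> H"
  shows "\<exists>\<psi>. arithmetic_subtree \<Lambda> (lists \<Lambda>) r q \<psi> \<and> prefix w (\<psi> []) \<and>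
    (\<forall>u\<in>word_ball \<Lambda> r. \<psi> u \<in> A \<and> length (\<psi> u) = c + q * length u)"
  using assms(3-)
proof (induction d arbitrary: w H r c)
  case 0
  then show ?case by (auto dest: spec[of _ 0])
next
  case (Suc d w H r c)
  have deeper: ?case if "l \<in> \<Lambda>" "H' \<in> replete \<Lambda> A d (w @ [l])" "\<And>i. i \<le> r \<Longrightarrow> c + q * i \<in> H'" for l H'
  proof -
    have "w @ [l] \<in> lists \<Lambda>" using Suc.prems(1) that(1) by simp
    from Suc.IH[OF this that(2,3)] show ?thesis by (meson append_prefixD)
  qed
  show ?case
  proof (cases "\<exists>l\<in>\<Lambda>. H \<in> replete \<Lambda> A d (w @ [l])")
    case True
    then show ?thesis using deeper Suc.prems(3) by blast
  next
    case False
    then obtain H' where w: "w \<in> A" and H: "H = insert (length w) H'"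
      and H': "\<And>l. l \<in> \<Lambda> \<Longrightarrow> H' \<in> replete \<Lambda> A d (w @ [l])"
      using Suc.prems(2) by (auto split: if_splits)
    obtain l0 where "l0 \<in> \<Lambda>" using assms(1) by blast
    have H'_gt: "length w < h" if "h \<in> H'" for h
      using replete_subset[OF assms(1) H'[OF \<open>l0 \<in> \<Lambda>\<close>]] that by auto
    show ?thesis
    proof (cases "c = length w")
      case False
      then have "length w < c" using Suc.prems(3)[of 0] H H'_gt by auto
      then have "c + q * i \<in> H'" if "i \<le> r" for i using Suc.prems(3)[OF that] H by auto
      then show ?thesis using deeper[OF \<open>l0 \<in> \<Lambda>\<close> H'[OF \<open>l0 \<in> \<Lambda>\<close>]] by blast
    next
      case c: True
      show ?thesis
      proof (cases r)
        case 0
        then show ?thesis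
          using w c Suc.prems(1) \<open>0 < q\<close>
          by (intro exI[of _ "\<lambda>_. w"]) (auto simp: arithmetic_subtree_def word_ball_def)
      next
        case (Suc r')
        have "\<forall>l\<in>\<Lambda>. \<exists>\<psi>. arithmetic_subtree \<Lambda> (lists \<Lambda>) r' q \<psi> \<and> prefix (w @ [l]) (\<psi> []) \<and>
          (\<forall>u\<in>word_ball \<Lambda> r'. \<psi> u \<in> A \<and> length (\<psi> u) = (c + q) + q * length u)"
        proof
          fix l assume l: "l \<in> \<Lambda>"
          have "c + q + q * i \<in> H'" if "i \<le> r'" for i
            using Suc.prems(3)[of "Suc i"] that H c \<open>0 < q\<close> Suc by (auto simp: add.assoc)
          then show "\<exists>\<psi>. arithmetic_subtree \<Lambda> (lists \<Lambda>) r' q \<psi> \<and> prefix (w @ [l]) (\<psi> []) \<and>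
            (\<forall>u\<in>word_ball \<Lambda> r'. \<psi> u \<in> A \<and> length (\<psi> u) = (c + q) + q * length u)"
            using Suc.IH[OF _ H'[OF l]] l Suc.prems(1) by simp
        qed
        from bchoice[OF this] obtain \<Psi> where \<Psi>: "\<And>l. l \<in> \<Lambda> \<Longrightarrow> arithmetic_subtree \<Lambda> (lists \<Lambda>) r' q (\<Psi> l)"
          "\<And>l. l \<in> \<Lambda> \<Longrightarrow> prefix (w @ [l]) (\<Psi> l [])"
          "\<And>l u. l \<in> \<Lambda> \<Longrightarrow> u \<in> word_ball \<Lambda> r' \<Longrightarrow> \<Psi> l u \<in> A \<and> length (\<Psi> l u) = c + q + q * length u"
          by blast
        define \<psi> where "\<psi> u = (case u of [] \<Rightarrow> w | l # u' \<Rightarrow> \<Psi> l u')" for u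
        have \<psi>_simps: "\<psi> [] = w" "\<And>l u. \<psi> (l # u) = \<Psi> l u" by (simp_all add: \<psi>_def)
        have lev: "\<psi> u \<in> A \<and> length (\<psi> u) = c + q * length u" if "u \<in> word_ball \<Lambda> r" for u
          using that w c \<Psi>(3) Suc by (cases u) (auto simp: \<psi>_simps word_ball_def)
        have lists: "\<psi> u \<in> lists \<Lambda>" if "u \<in> word_ball \<Lambda> r" for u
        proof (cases u)
          case Nil
          then show ?thesis using Suc.prems(1) by (simp add: \<psi>_simps)
        next
          case (Cons l u')
          then have "l \<in> \<Lambda>" "u' \<in> word_ball \<Lambda> r'" using that \<open>r = Suc r'\<close> by (auto simp: word_ball_def)
          then show ?thesis using \<Psi>(1)[of l] Cons by (auto simp: \<psi>_simps arithmetic_subtree_def)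
        qed
        have step: "length (\<psi> (u @ [l])) = length (\<psi> u) + q \<and> prefix (\<psi> u @ [l]) (\<psi> (u @ [l]))"
          if u: "u \<in> lists \<Lambda>" "length u < r" and l: "l \<in> \<Lambda>" for u l
        proof (cases u)
          case Nil
          then show ?thesis
            using \<Psi>(2)[OF l] \<Psi>(3)[OF l, of "[]"] c by (simp add: \<psi>_simps word_ball_def)
        next
          case (Cons l' u')
          then have "l' \<in> \<Lambda>" "u' \<in> lists \<Lambda>" "length u' < r'" using u \<open>r = Suc r'\<close> by auto
          then show ?thesis using \<Psi>(1)[of l'] l Cons by (simp add: \<psi>_simps arithmetic_subtree_def)
        qed
        show ?thesis
          using lev lists step \<open>0 < q\<close>
          by (intro exI[of _ \<psi>]) (auto simp: arithmetic_subtree_def \<psi>_simps)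
      qed
    qed
  qed
qed

text \<open>\<open>\<psi> v @ [l]\<close> and \<open>\<psi> v' @ [l']\<close> are prefixes of one
  word and have the same length, hence agree; this gives the last letters and passes the equality on
  to \<open>v\<close> and \<open>v'\<close>.\<close>

lemma arithmetic_subtree_inj:
  assumes "arithmetic_subtree \<Lambda> S r q \<psi>" "u \<in> word_ball \<Lambda> r" "u' \<in> word_ball \<Lambda> r"
    "length u = length u'" "\<psi> u = \<psi> u'"
  shows "u = u'"
  using assms(2-)
proof (induction u arbitrary: u' rule: rev_induct)
  case (snoc l v)
  then obtain l' v' where u': "u' = v' @ [l']" by (cases u' rule: rev_cases) auto
  have v: "v \<in> lists \<Lambda>" "l \<in> \<Lambda>" "length v < r" "v' \<in> lists \<Lambda>" "l' \<in> \<Lambda>" "length v' < r" "length v = length v'"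
    using snoc.prems by (auto simp: word_ball_def u')
  have step: "length (\<psi> (w @ [l])) = length (\<psi> w) + q" "prefix (\<psi> w @ [l]) (\<psi> (w @ [l]))"
    if "w \<in> lists \<Lambda>" "length w < r" "l \<in> \<Lambda>" for w l
    using assms(1) that unfolding arithmetic_subtree_def by blast+
  have eq: "\<psi> (v @ [l]) = \<psi> (v' @ [l'])" using snoc.prems(4) by (simp add: u')
  then have len: "length (\<psi> v @ [l]) = length (\<psi> v' @ [l'])"
    using step(1)[OF v(1,3,2)] step(1)[OF v(4,6,5)] by simp
  have "prefix (\<psi> v @ [l]) (\<psi> v' @ [l'])"
    using prefix_length_prefix[OF step(2)[OF v(1,3,2), unfolded eq] step(2)[OF v(4,6,5)]] len by simp
  then have "\<psi> v @ [l] = \<psi> v' @ [l']" using len by (auto simp: prefix_def)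
  then show ?case using snoc.IH[of v'] v by (auto simp: u' word_ball_def)
qed simp

section \<open>Dense fibres and the construction of the map\<close>

lemma card_level_set:
  assumes "finite \<Lambda>"
  shows "card (level_set \<Lambda> i j) = card \<Lambda> ^ i * card \<Lambda> ^ j"
    and "card (A \<inter> level_set \<Lambda> i j) = (\<Sum>y\<in>word_level \<Lambda> j. card {x \<in> word_level \<Lambda> i. (x, y) \<in> A})"
proof -
  have L: "level_set \<Lambda> i j = word_level \<Lambda> i \<times> word_level \<Lambda> j"
    by (auto simp: level_set_def word_pairs_def level_def word_level_def lists_eq_set)
  then show "card (level_set \<Lambda> i j) = card \<Lambda> ^ i * card \<Lambda> ^ j"
    using assms by (simp add: card_cartesian_product card_word_level)
  have "A \<inter> level_set \<Lambda> i j = (\<Union>y\<in>word_level \<Lambda> j. (\<lambda>x. (x, y)) ` {x \<in> word_level \<Lambda> i. (x, y) \<in> A})"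
    unfolding L by auto
  also have "card \<dots> = (\<Sum>y\<in>word_level \<Lambda> j. card ((\<lambda>x. (x, y)) ` {x \<in> word_level \<Lambda> i. (x, y) \<in> A}))"
    using assms by (intro card_UN_disjoint) (auto simp: finite_word_level)
  also have "\<dots> = (\<Sum>y\<in>word_level \<Lambda> j. card {x \<in> word_level \<Lambda> i. (x, y) \<in> A})"
    by (intro sum.cong refl card_image) (auto intro: inj_onI)
  finally show "card (A \<inter> level_set \<Lambda> i j) = (\<Sum>y\<in>word_level \<Lambda> j. card {x \<in> word_level \<Lambda> i. (x, y) \<in> A})" .
qed

text \<open>The density on a level is the average over \<open>y\<close> of the fibre densities.
  Averaging their sum over \<open>i < N\<close>, and not each term, yields one \<open>y\<close> that
  serves all \<open>i\<close> together.\<close>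

lemma exists_dense_fiber:
  assumes "finite \<Lambda>" "\<Lambda> \<noteq> {}"
  shows "\<exists>y\<in>word_level \<Lambda> j.
    (\<Sum>i<N. real (card (A \<inter> level_set \<Lambda> i j)) / real (card (level_set \<Lambda> i j))) \<le>
    (\<Sum>i<N. real (card {x \<in> word_level \<Lambda> i. (x, y) \<in> A}) / real (card \<Lambda>) ^ i)"
proof (rule ccontr)
  assume no: "\<not> ?thesis"
  define T where "T y = (\<Sum>i<N. real (card {x \<in> word_level \<Lambda> i. (x, y) \<in> A}) / real (card \<Lambda>) ^ i)" for y
  let ?a = "\<Sum>i<N. real (card (A \<inter> level_set \<Lambda> i j)) / real (card (level_set \<Lambda> i j))"
  have k: "0 < real (card \<Lambda>)" using assms by (simp add: card_gt_0_iff)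
  have "?a = (\<Sum>i<N. (\<Sum>y\<in>word_level \<Lambda> j. real (card {x \<in> word_level \<Lambda> i. (x, y) \<in> A}) / real (card \<Lambda>) ^ i)) / real (card \<Lambda>) ^ j"
    by (simp add: card_level_set[OF assms(1)] sum_divide_distrib)
  also have "(\<Sum>i<N. (\<Sum>y\<in>word_level \<Lambda> j. real (card {x \<in> word_level \<Lambda> i. (x, y) \<in> A}) / real (card \<Lambda>) ^ i)) = (\<Sum>y\<in>word_level \<Lambda> j. T y)"
    unfolding T_def by (rule sum.swap)
  finally have "?a * real (card (word_level \<Lambda> j)) = (\<Sum>y\<in>word_level \<Lambda> j. T y)"
    using k by (simp add: card_word_level[OF assms(1)])
  moreover have "(\<Sum>y\<in>word_level \<Lambda> j. T y) < real (card (word_level \<Lambda> j)) * ?a"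
    using no assms by (intro sum_bounded_above_strict) (auto simp: T_def not_le card_word_level card_gt_0_iff)
  ultimately show False by (simp add: mult.commute)
qed

theorem theorem1p6:
  fixes \<Lambda> :: "'a set" and A :: "('a list \<times> 'a list) set" and r :: nat
  assumes "finite \<Lambda>" and "\<Lambda> \<noteq> {}"
    and "A \<subseteq> word_pairs \<Lambda>"
    and "upper_density \<Lambda> A > 0"
    and "r > 0"
  shows "\<exists>(q::nat) (\<phi> :: 'a list \<times> nat \<Rightarrow> 'a list \<times> 'a list). q > 0 \<and>
    \<phi> \<in> word_ball \<Lambda> r \<times> {0..r} \<rightarrow> A \<and>
    inj_on \<phi> (word_ball \<Lambda> r \<times> {0..r}) \<and>
    (\<exists>c1 c2 :: nat. \<forall>u\<in>word_ball \<Lambda> r. \<forall>j\<in>{0..r}.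
       level (\<phi> (u, j)) = (q * length u + c1, q * j + c2)) \<and>
    (\<forall>j\<in>{0..r}. \<exists>\<psi> y. arithmetic_subtree \<Lambda> (lists \<Lambda>) r q \<psi> \<and> y \<in> lists \<Lambda> \<and>
       (\<forall>u\<in>word_ball \<Lambda> r. \<phi> (u, j) = (\<psi> u, y)))"
proof -
  define k where "k = real (card \<Lambda>)"
  have k: "0 < k" using assms(1,2) by (simp add: k_def card_gt_0_iff)
  define a where "a i j = real (card (A \<inter> level_set \<Lambda> i j)) / real (card (level_set \<Lambda> i j))" for i j
  obtain b' where b': "0 < ereal b'" "ereal b' < upper_density \<Lambda> A"
    using ereal_dense2[OF assms(4)] by auto
  \<comment> \<open>\<open>many_large\<close> leaves half of \<open>b'\<close> both as the
    proportion of good \<open>j\<close> and as the average density of the fibre for each of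
    them.\<close>
  define b where "b = b' / 2"
  have "0 < b" using b' by (simp add: b_def)
  have "\<exists>N\<ge>M. b' * (real N)\<^sup>2 \<le> (\<Sum>i<N. \<Sum>j<N. a i j)" for M
  proof (rule ccontr)
    assume no: "\<not> ?thesis"
    have "ereal (1 / (real N)\<^sup>2 * (\<Sum>i<N. \<Sum>j<N. a i j)) \<le> ereal b'" if "N \<ge> max M 1" for N
    proof -
      have "(\<Sum>i<N. \<Sum>j<N. a i j) \<le> b' * (real N)\<^sup>2" using no that by (meson linear max.boundedE)
      then show ?thesis using that by (simp add: pos_divide_le_eq)
    qed
    then have "upper_density \<Lambda> A \<le> ereal b'"
      unfolding upper_density_def a_def by (intro Limsup_bounded eventually_sequentiallyI[of "max M 1"])
    then show False using b'(2) by simp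
  qed
  note dense = this
  define \<rho> where "\<rho> = 1 + 1 / k"
  have \<rho>: "0 < ln \<rho>" unfolding \<rho>_def using k by (intro ln_gt_zero) simp
  then have "0 < ln \<rho> * b" using \<open>0 < b\<close> by simp
  from large_member_of_large_family[OF this] obtain c where c: "0 < c"
    "\<And>N F. F \<subseteq> Pow {..<N} \<Longrightarrow> F \<noteq> {} \<Longrightarrow> ln \<rho> * b * real N \<le> ln (real (card F)) \<Longrightarrow> \<exists>H\<in>F. c * real N \<le> real (card H)"
    by blast
  have "0 < b * c" using \<open>0 < b\<close> c(1) by simp
  from grid_in_dense_set[OF this, of r] obtain N0 where N0: "\<And>N B. N \<ge> N0 \<Longrightarrow> B \<subseteq> {..<N} \<times> {..<N} \<Longrightarrow>
      b * c * (real N)\<^sup>2 \<le> real (card B) \<Longrightarrow> \<exists>q>0. \<exists>c1 c2. \<forall>i\<le>r. \<forall>j\<le>r. (c1 + q * i, c2 + q * j) \<in> B"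
    by meson
  \<comment> \<open>\<open>Suc N0\<close> rather than \<open>N0\<close> ensures
    \<open>N > 0\<close>, which \<open>many_large\<close> needs for its bound
    \<open>G\<close>.\<close>
  obtain N where N: "N \<ge> Suc N0" "b' * (real N)\<^sup>2 \<le> (\<Sum>i<N. \<Sum>j<N. a i j)" using dense by blast
  define T where "T y = (\<Sum>i<N. real (card {x \<in> word_level \<Lambda> i. (x, y) \<in> A}) / k ^ i)" for y
  have "\<forall>j. \<exists>y. y \<in> word_level \<Lambda> j \<and> (\<Sum>i<N. a i j) \<le> T y"
    using exists_dense_fiber[OF assms(1,2)] unfolding T_def a_def k_def by blast
  from choice[OF this] obtain Y where Y: "\<And>j. Y j \<in> word_level \<Lambda> j" "\<And>j. (\<Sum>i<N. a i j) \<le> T (Y j)" by blast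
  define J where "J = {j \<in> {..<N}. b' / 2 * real N \<le> T (Y j)}"
  have "b' / 2 * real (card {..<N}) \<le> real (card J)"
    unfolding J_def
  proof (rule many_large)
    fix j
    have "real (card {x \<in> word_level \<Lambda> i. (x, Y j) \<in> A}) / k ^ i \<le> 1" for i
    proof -
      have "card {x \<in> word_level \<Lambda> i. (x, Y j) \<in> A} \<le> card \<Lambda> ^ i"
        unfolding card_word_level[OF assms(1), symmetric] using finite_word_level[OF assms(1)] by (intro card_mono) auto
      then have "real (card {x \<in> word_level \<Lambda> i. (x, Y j) \<in> A}) \<le> k ^ i"
        by (simp add: k_def flip: of_nat_power)
      then show ?thesis using k by simp
    qed
    then have "T (Y j) \<le> (\<Sum>i<N. 1)" unfolding T_def by (intro sum_mono)
    then show "T (Y j) \<le> real N" by simp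
  next
    have "(\<Sum>i<N. \<Sum>j<N. a i j) = (\<Sum>j<N. \<Sum>i<N. a i j)" by (rule sum.swap)
    also have "\<dots> \<le> (\<Sum>j<N. T (Y j))" using Y(2) by (intro sum_mono)
    finally show "b' * real (card {..<N}) * real N \<le> (\<Sum>j<N. T (Y j))"
      using N(2) by (simp add: power2_eq_square)
  qed (use N b' in auto)
  then have J: "b * real N \<le> real (card J)" by (simp add: b_def)
  let ?R = "\<lambda>j. replete \<Lambda> {x. (x, Y j) \<in> A} N []"
  have "\<exists>H\<in>?R j. c * real N \<le> real (card H)" if "j \<in> J" for j
  proof (rule c(2))
    show "?R j \<subseteq> Pow {..<N}" using replete_subset[OF assms(2)] by fastforce
    show "?R j \<noteq> {}" using empty_in_replete[OF assms(2)] by blast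
    have "ln \<rho> * b * real N \<le> ln \<rho> * T (Y j)"
      unfolding mult.assoc using that \<rho> by (intro mult_left_mono) (auto simp: J_def b_def)
    also have "\<dots> \<le> ln (real (card (?R j)))"
      using ln_card_replete[OF assms(1,2), where w = "[]" and A = "{x. (x, Y j) \<in> A}" and d = N]
      by (simp add: T_def \<rho>_def k_def)
    finally show "ln \<rho> * b * real N \<le> ln (real (card (?R j)))" .
  qed
  then have "\<forall>j\<in>J. \<exists>H. H \<in> ?R j \<and> c * real N \<le> real (card H)" by blast
  from bchoice[OF this] obtain H where H: "\<And>j. j \<in> J \<Longrightarrow> H j \<in> ?R j" "\<And>j. j \<in> J \<Longrightarrow> c * real N \<le> real (card (H j))"
    by blast
  have HN: "H j \<subseteq> {..<N}" if "j \<in> J" for j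
    using replete_subset[OF assms(2) H(1)[OF that]] by auto
  have "finite J" by (simp add: J_def)
  \<comment> \<open>At least \<open>b * N\<close> rows, each with at least \<open>c * N\<close>
    levels from one replete set. A grid in \<open>B\<close> selects rows \<open>c2 + q * j\<close>,
    and in each the progression of levels for a subtree.\<close>
  define B where "B = (\<Union>j\<in>J. (\<lambda>i. (i, j)) ` H j)"
  have "card B = (\<Sum>j\<in>J. card ((\<lambda>i. (i, j)) ` H j))"
    unfolding B_def using finite_subset[OF HN] \<open>finite J\<close> by (intro card_UN_disjoint) auto
  also have "\<dots> = (\<Sum>j\<in>J. card (H j))"
    by (intro sum.cong refl card_image) (auto intro: inj_onI)
  finally have "real (card B) = (\<Sum>j\<in>J. real (card (H j)))" by simp
  also have "\<dots> \<ge> (\<Sum>j\<in>J. c * real N)" using H(2) by (intro sum_mono) auto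
  finally have "real (card J) * (c * real N) \<le> real (card B)" by simp
  moreover have "b * real N * (c * real N) \<le> real (card J) * (c * real N)"
    using J c(1) by (intro mult_right_mono) auto
  ultimately have "b * c * (real N)\<^sup>2 \<le> real (card B)" by (simp add: power2_eq_square mult_ac)
  moreover have "B \<subseteq> {..<N} \<times> {..<N}" using HN by (auto simp: B_def J_def)
  ultimately have "\<exists>q>0. \<exists>c1 c2. \<forall>i\<le>r. \<forall>j\<le>r. (c1 + q * i, c2 + q * j) \<in> B"
    using N0[of N B] N(1) by simp
  then obtain q c1 c2 where q: "0 < q" and grid: "\<And>i j. i \<le> r \<Longrightarrow> j \<le> r \<Longrightarrow> (c1 + q * i, c2 + q * j) \<in> B"
    by blast
  have inJ: "c2 + q * j \<in> J" if "j \<le> r" for j using grid[of 0 j] that by (auto simp: B_def)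
  have "\<exists>\<psi>. arithmetic_subtree \<Lambda> (lists \<Lambda>) r q \<psi> \<and>
      (\<forall>u\<in>word_ball \<Lambda> r. (\<psi> u, Y (c2 + q * j)) \<in> A \<and> length (\<psi> u) = c1 + q * length u)" if "j \<le> r" for j
  proof -
    have "c1 + q * i \<in> H (c2 + q * j)" if "i \<le> r" for i
      using grid[OF that \<open>j \<le> r\<close>] by (auto simp: B_def)
    from subtree_of_replete[OF assms(2) q _ H(1)[OF inJ[OF that]] this]
    show ?thesis by auto
  qed
  then have "\<forall>j\<in>{..r}. \<exists>\<psi>. arithmetic_subtree \<Lambda> (lists \<Lambda>) r q \<psi> \<and>
      (\<forall>u\<in>word_ball \<Lambda> r. (\<psi> u, Y (c2 + q * j)) \<in> A \<and> length (\<psi> u) = c1 + q * length u)" by simp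
  from bchoice[OF this] obtain \<Psi> where \<Psi>: "\<And>j. j \<le> r \<Longrightarrow> arithmetic_subtree \<Lambda> (lists \<Lambda>) r q (\<Psi> j)"
    "\<And>j u. j \<le> r \<Longrightarrow> u \<in> word_ball \<Lambda> r \<Longrightarrow> (\<Psi> j u, Y (c2 + q * j)) \<in> A"
    "\<And>j u. j \<le> r \<Longrightarrow> u \<in> word_ball \<Lambda> r \<Longrightarrow> length (\<Psi> j u) = c1 + q * length u"
    by (metis atMost_iff)
  have Y_len: "length (Y j) = j" "Y j \<in> lists \<Lambda>" for j
    using Y(1)[of j] by (auto simp: word_level_def)
  define \<phi> where "\<phi> = (\<lambda>(u, j). (\<Psi> j u, Y (c2 + q * j)))"
  have "inj_on \<phi> (word_ball \<Lambda> r \<times> {0..r})"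
  proof (rule inj_onI, clarify)
    fix u j u' j'
    assume u: "u \<in> word_ball \<Lambda> r" "u' \<in> word_ball \<Lambda> r" and j: "j \<in> {0..r}" "j' \<in> {0..r}"
      and eq: "\<phi> (u, j) = \<phi> (u', j')"
    \<comment> \<open>The length of the second coordinate determines \<open>j\<close>; the length of
      the first then determines \<open>length u\<close>, as \<open>arithmetic_subtree_inj\<close>
      requires.\<close>
    have "Y (c2 + q * j) = Y (c2 + q * j')" using eq by (simp add: \<phi>_def)
    then have "c2 + q * j = c2 + q * j'" using Y_len(1) by metis
    then have jj: "j = j'" using q by simp
    have \<Psi>eq: "\<Psi> j u = \<Psi> j u'" using eq by (simp add: \<phi>_def jj)
    then have "c1 + q * length u = c1 + q * length u'" using \<Psi>(3) u j(1) by (metis atLeastAtMost_iff)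
    then have "length u = length u'" using q by simp
    then show "u = u' \<and> j = j'"
      using arithmetic_subtree_inj[OF \<Psi>(1) u _ \<Psi>eq] j jj by simp
  qed
  moreover have "\<phi> \<in> word_ball \<Lambda> r \<times> {0..r} \<rightarrow> A" using \<Psi>(2) by (auto simp: \<phi>_def)
  moreover have "\<forall>u\<in>word_ball \<Lambda> r. \<forall>j\<in>{0..r}. level (\<phi> (u, j)) = (q * length u + c1, q * j + c2)"
    using \<Psi>(3) Y_len(1) by (simp add: \<phi>_def level_def)
  moreover have "\<forall>j\<in>{0..r}. \<exists>\<psi> y. arithmetic_subtree \<Lambda> (lists \<Lambda>) r q \<psi> \<and> y \<in> lists \<Lambda> \<and>
       (\<forall>u\<in>word_ball \<Lambda> r. \<phi> (u, j) = (\<psi> u, y))"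
    using \<Psi>(1) Y_len(2) unfolding \<phi>_def by (metis (mono_tags, lifting) atLeastAtMost_iff case_prod_conv)
  ultimately show ?thesis using q by blast
qed

end
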